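(* Let $m\geq 2$ be an integer. Assume that the group $H_{4,m}$ is sofic. Then, for every $\epsilon>0$, there is an $N>0$ such that, for every integer $n\geq N$ coprime to $m$, there is a bijection $f:\mathbb{Z}/n\mathbb{Z}\to\mathbb{Z}/n\mathbb{Z}$ such that $$f(x+1)=m f(x)$$ for at least $(1-\epsilon)n$ elements $x$ of $\mathbb{Z}/n\mathbb{Z}$, and $$f(f(f(f(x))))=x$$ for all $x\in\mathbb{Z}/n\mathbb{Z}$.
   Context: The group $H_{4,m}$ is the group generated by $a_1,a_2,a_3,a_4$ subject to the relations $a_1^{-1}a_2a_1=a_2^m$, $a_2^{-1}a_3a_2=a_3^m$, $a_3^{-1}a_4a_3=a_4^m$, $a_4^{-1}a_1a_4=a_1^m$. $\mathrm{Sym}(n)$ is the group of permutations of $\{1,\dotsc,n\}$, with identity $\mathrm{id}$, and $d_h(g_1,g_2)=\frac1n|\{1\leq i\leq n: g_1(i)\neq g_2(i)\}|$ is the normalized Hamming distance. For a group $G$, a finite subset $S\subset G$, $\delta>0$ and $n\in\mathbb{Z}^+$, an $(S,\delta,n)$-sofic approximation is a map $\phi:S\to\mathrm{Sym}(n)$ such that (1) $d_h(\phi(g)\phi(h),\phi(gh))<\delta$ for all $g,h\in S$ such that $gh\in S$, and (2) $d_h(\phi(g),\mathrm{id})>1-\delta$ for all $g\in S$ distinct from the identity $e$. The group $G$ is sofic if, for every finite subset $S\subset G$ and every $\delta>0$, there is an $(S,\delta,n)$-sofic approximation for some $n\in\mathbb{Z}^+$. *)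

theory Defs
  imports Complex_Main "HOL-Algebra.Sym_Groups" "HOL-Number_Theory.Residues"
begin

section \<open>Groups given by generators and relations\<close>

datatype 'a letter = Pos 'a | Neg 'a

text \<open>Words are lists of letters, where \<open>Neg a\<close> stands for the formal inverse of the generator
  \<open>a\<close>; every element of the type \<open>'a\<close> is a generator.  A pair \<open>(l, r)\<close> of words in \<open>R\<close> is the
  relation \<open>l = r\<close>.  The predicate below is the least congruence on words that makes formally
  inverse letters cancel and identifies the two sides of every relation in \<open>R\<close>.\<close>

inductive word_eq :: "('a letter list \<times> 'a letter list) set \<Rightarrow> 'a letter list \<Rightarrow> 'a letter list \<Rightarrow> bool"
  for R where
  refl: "word_eq R u u"
| sym: "word_eq R u v \<Longrightarrow> word_eq R v u"
| trans: "word_eq R u v \<Longrightarrow> word_eq R v w \<Longrightarrow> word_eq R u w"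
| cancel_pos: "word_eq R (u @ [Pos a, Neg a] @ v) (u @ v)"
| cancel_neg: "word_eq R (u @ [Neg a, Pos a] @ v) (u @ v)"
| relation: "(l, r) \<in> R \<Longrightarrow> word_eq R (u @ l @ v) (u @ r @ v)"

definition word_class ::
  "('a letter list \<times> 'a letter list) set \<Rightarrow> 'a letter list \<Rightarrow> 'a letter list set"
  where "word_class R u = {v. word_eq R u v}"

definition presented_group ::
  "('a letter list \<times> 'a letter list) set \<Rightarrow> 'a letter list set monoid"
  where "presented_group R =
    \<lparr>carrier = range (word_class R),
     mult = (\<lambda>A B. \<Union>u\<in>A. \<Union>v\<in>B. word_class R (u @ v)),
     one = word_class R []\<rparr>"

lemma word_eq_context: "word_eq R u v \<Longrightarrow> word_eq R (p @ u @ q) (p @ v @ q)"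
proof (induction rule: word_eq.induct)
  case (cancel_pos u a v)
  show ?case using word_eq.cancel_pos[of R "p @ u" a "v @ q"] by simp
next
  case (cancel_neg u a v)
  show ?case using word_eq.cancel_neg[of R "p @ u" a "v @ q"] by simp
next
  case (relation l r u v)
  then show ?case using word_eq.relation[of l r R "p @ u" "v @ q"] by simp
next
  case (refl u)
  show ?case by (rule word_eq.refl)
next
  case (sym u v)
  from sym.IH show ?case by (rule word_eq.sym)
next
  case (trans u v w)
  from trans.IH show ?case by (rule word_eq.trans)
qed

lemma word_eq_append:
  assumes "word_eq R u u'" "word_eq R v v'"
  shows "word_eq R (u @ v) (u' @ v')"
  using word_eq.trans[OF word_eq_context[OF assms(1), of "[]" v, simplified]
    word_eq_context[OF assms(2), of u' "[]", simplified]] .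

lemma word_class_eq_iff: "word_class R u = word_class R v \<longleftrightarrow> word_eq R u v"
proof
  assume "word_class R u = word_class R v"
  moreover have "v \<in> word_class R v"
    by (simp add: word_class_def word_eq.refl)
  ultimately have "v \<in> word_class R u"
    by (simp only:)
  then show "word_eq R u v"
    by (simp add: word_class_def)
next
  assume "word_eq R u v"
  then have "word_eq R u w \<longleftrightarrow> word_eq R v w" for w
    by (metis word_eq.sym word_eq.trans)
  then show "word_class R u = word_class R v"
    by (simp add: word_class_def)
qed

lemma mult_word_class:
  "word_class R u \<otimes>\<^bsub>presented_group R\<^esub> word_class R v = word_class R (u @ v)"
proof -
  have *: "word_class R (u' @ v') = word_class R (u @ v)"
    if "u' \<in> word_class R u" "v' \<in> word_class R v" for u' v'
  proof -
    have "word_eq R (u @ v) (u' @ v')"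
      using that by (intro word_eq_append) (simp_all add: word_class_def)
    then show ?thesis
      unfolding word_class_eq_iff by (rule word_eq.sym)
  qed
  have "u \<in> word_class R u" "v \<in> word_class R v"
    by (simp_all add: word_class_def word_eq.refl)
  then have "(\<Union>u'\<in>word_class R u. \<Union>v'\<in>word_class R v. word_class R (u' @ v')) = word_class R (u @ v)"
    using * by blast
  then show ?thesis
    by (simp add: presented_group_def)
qed

fun letter_inv :: "'a letter \<Rightarrow> 'a letter" where
  "letter_inv (Pos a) = Neg a"
| "letter_inv (Neg a) = Pos a"

lemma word_eq_inverse: "word_eq R (rev (map letter_inv u) @ u) []"
proof (induction u)
  case (Cons x u)
  have "word_eq R (rev (map letter_inv u) @ [letter_inv x, x] @ u) (rev (map letter_inv u) @ u)"
    by (cases x) (simp_all only: letter_inv.simps word_eq.cancel_pos word_eq.cancel_neg)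
  from word_eq.trans[OF this Cons.IH] show ?case by simp
qed (simp add: word_eq.refl)

lemma group_presented_group: "group (presented_group R)"
proof (rule groupI)
  have carrier: "carrier (presented_group R) = range (word_class R)"
    and one: "\<one>\<^bsub>presented_group R\<^esub> = word_class R []"
    by (simp_all add: presented_group_def)
  show "\<one>\<^bsub>presented_group R\<^esub> \<in> carrier (presented_group R)"
    by (simp add: carrier one)
  fix x assume x: "x \<in> carrier (presented_group R)"
  then obtain u where u: "x = word_class R u"
    unfolding carrier by (rule imageE)
  show "\<one>\<^bsub>presented_group R\<^esub> \<otimes>\<^bsub>presented_group R\<^esub> x = x"
    by (simp add: u one mult_word_class)
  have "word_class R (rev (map letter_inv u)) \<otimes>\<^bsub>presented_group R\<^esub> x = \<one>\<^bsub>presented_group R\<^esub>"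
    by (simp add: u one mult_word_class word_class_eq_iff word_eq_inverse)
  moreover have "word_class R (rev (map letter_inv u)) \<in> carrier (presented_group R)"
    unfolding carrier by (rule rangeI)
  ultimately show "\<exists>y\<in>carrier (presented_group R). y \<otimes>\<^bsub>presented_group R\<^esub> x = \<one>\<^bsub>presented_group R\<^esub>"
    by (rule bexI)
  fix y assume "y \<in> carrier (presented_group R)"
  then obtain v where v: "y = word_class R v"
    unfolding carrier by (rule imageE)
  show "x \<otimes>\<^bsub>presented_group R\<^esub> y \<in> carrier (presented_group R)"
    unfolding u v mult_word_class carrier by (rule rangeI)
  fix z assume "z \<in> carrier (presented_group R)"
  then obtain w where w: "z = word_class R w"
    unfolding carrier by (rule imageE)
  show "x \<otimes>\<^bsub>presented_group R\<^esub> y \<otimes>\<^bsub>presented_group R\<^esub> z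
      = x \<otimes>\<^bsub>presented_group R\<^esub> (y \<otimes>\<^bsub>presented_group R\<^esub> z)"
    by (simp add: u v w mult_word_class)
qed


section \<open>The groups \<open>H\<^sub>4\<^sub>,\<^sub>m\<close>\<close>

datatype gen4 = a1 | a2 | a3 | a4

definition H4_relations :: "nat \<Rightarrow> (gen4 letter list \<times> gen4 letter list) set"
  where "H4_relations m =
    {([Neg a1, Pos a2, Pos a1], replicate m (Pos a2)),
     ([Neg a2, Pos a3, Pos a2], replicate m (Pos a3)),
     ([Neg a3, Pos a4, Pos a3], replicate m (Pos a4)),
     ([Neg a4, Pos a1, Pos a4], replicate m (Pos a1))}"

definition H4 :: "nat \<Rightarrow> gen4 letter list set monoid"
  where "H4 m = presented_group (H4_relations m)"


section \<open>Sofic groups\<close>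

definition hamming_dist :: "nat \<Rightarrow> (nat \<Rightarrow> nat) \<Rightarrow> (nat \<Rightarrow> nat) \<Rightarrow> real"
  where "hamming_dist n g h = real (card {i \<in> {1..n}. g i \<noteq> h i}) / real n"

definition sofic_approximation ::
  "('a, 'b) monoid_scheme \<Rightarrow> 'a set \<Rightarrow> real \<Rightarrow> nat \<Rightarrow> ('a \<Rightarrow> nat \<Rightarrow> nat) \<Rightarrow> bool"
  where "sofic_approximation G S \<delta> n \<phi> \<longleftrightarrow>
    (\<forall>g\<in>S. \<phi> g \<in> carrier (sym_group n)) \<and>
    (\<forall>g\<in>S. \<forall>h\<in>S. g \<otimes>\<^bsub>G\<^esub> h \<in> S \<longrightarrow>
       hamming_dist n (\<phi> g \<otimes>\<^bsub>sym_group n\<^esub> \<phi> h) (\<phi> (g \<otimes>\<^bsub>G\<^esub> h)) < \<delta>) \<and>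
    (\<forall>g\<in>S. g \<noteq> \<one>\<^bsub>G\<^esub> \<longrightarrow> hamming_dist n (\<phi> g) \<one>\<^bsub>sym_group n\<^esub> > 1 - \<delta>)"

definition sofic :: "('a, 'b) monoid_scheme \<Rightarrow> bool"
  where "sofic G \<longleftrightarrow>
    (\<forall>S \<delta>. finite S \<and> S \<subseteq> carrier G \<and> \<delta> > 0 \<longrightarrow>
       (\<exists>n>0. \<exists>\<phi>. sofic_approximation G S \<delta> n \<phi>))"

end

theory Submission
  imports Defs
begin

text \<open>
  Write \<open>A\<close>, \<open>B\<close> for consecutive generators \<open>a\<^sub>i\<close>, \<open>a\<^sub>i\<^sub>+\<^sub>1\<close>; they satisfy \<open>B A = A B\<^sup>m\<close> and generate an amenable
  Baumslag-Solitar group.  On \<open>\<int>/n\<int>\<close> the same relation holds for \<open>B' x = x - 1\<close> and \<open>A' x = x / m\<close>.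
  Any two almost free almost actions of this group on sets with the same number of points are
  almost conjugate (in the manner of Elek and Szabo): quasi-tile both sets greedily by
  corresponding translates of Foelner sets, starting with the most invariant ones.
  Four copies of a sofic approximation of the group, shifted cyclically in the index of the
  generators, are permuted by a map \<open>f\<close> with \<open>f B = A f\<close> and \<open>f\<^sup>4 = id\<close>.  Transporting \<open>f\<close> along an almost
  conjugation \<open>\<sigma>\<close> to \<open>\<int>/n\<int>\<close> gives the bijection; equations \<open>f (x + 1) = m f x\<close> fail only where \<open>\<sigma>\<close> fails
  to intertwine the two almost actions.

  Almost freeness requires that the generators have infinite order.  For this, an action of
  \<open>\<langle>a\<^sub>1, a\<^sub>2, a\<^sub>3\<rangle>\<close> is constructed in which \<open>a\<^sub>1\<close>, \<open>a\<^sub>3\<close> generate a free group acting freely; there is then an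
  involution \<open>\<tau>\<close> of the space exchanging \<open>a\<^sub>1\<close> and \<open>a\<^sub>3\<close>, and \<open>a\<^sub>4 = \<tau> a\<^sub>2 \<tau>\<close> completes the action.
\<close>

section \<open>Quasi-tilings and partial conjugacies\<close>

text \<open>Uniqueness up to almost conjugacy rests on Foelner sets, so it is applied to pairs of
  consecutive generators and never to the whole group. A single application suffices: the four pairs
  sit side by side as tagged copies in one almost action, and advancing the tag has order four and
  carries \<open>B\<close> to \<open>A\<close> without error. Conjugation keeps the fourth power
  exactly equal to the identity, so the whole error falls on the recurrence. With B' and A' as
  above, f B' = A' f reads f (x - 1) = f x / m; division by m is a permutation because n is coprime
  to m.

  Soficity yields only one unspecified size; repeated copies and a few fixed points reach every
  large n.

  Only the elements A^i B^j with i, j nonnegative are used. They are closed under multiplication, so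
  pairs of naturals suffice.

  In the tiling, a translate of a Foelner set \<open>F\<close> must find room beside the earlier
  tiles. If their union is almost invariant under \<open>F\<close>, most points outside it have a
  translate that misses it entirely. Hence the Foelner sets are chosen in the order opposite to that
  in which they are placed.\<close>

text \<open>\<open>U\<close> and \<open>V\<close> are the unions of the tiles used so far in the two spaces; tiles may overlap a little, and
  \<open>D \<subseteq> U\<close> is the part on which the matching \<open>\<sigma>\<close> of corresponding tile points is defined.\<close>

definition partial_conjugacy ::
  "real \<Rightarrow> 'g set \<Rightarrow> ('g \<Rightarrow> 'a \<Rightarrow> 'a) \<Rightarrow> ('g \<Rightarrow> 'b \<Rightarrow> 'b) \<Rightarrow> 'a set \<Rightarrow> 'b set \<Rightarrow> 'a set \<Rightarrow> ('a \<Rightarrow> 'b) \<Rightarrow> bool"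
  where "partial_conjugacy \<epsilon> S a b U V D \<sigma> \<longleftrightarrow>
    D \<subseteq> U \<and> \<sigma> ` D \<subseteq> V \<and> inj_on \<sigma> D \<and>
    (1 - 2 * \<epsilon>) * real (card U) \<le> card D \<and> (1 - 2 * \<epsilon>) * real (card V) \<le> card D \<and>
    (\<forall>s\<in>S. real (card {d \<in> D. a s d \<notin> D \<or> \<sigma> (a s d) \<noteq> b s (\<sigma> d)}) \<le> 6 * \<epsilon> * real (card D))"

text \<open>The bound \<open>r\<close> is an absolute count. With \<open>mul\<close> in place of
  \<open>a\<close>, the same predicate expresses the Foelner property of a set of group
  elements.\<close>

definition almost_invariant :: "('g \<Rightarrow> 'a \<Rightarrow> 'a) \<Rightarrow> 'g set \<Rightarrow> real \<Rightarrow> 'a set \<Rightarrow> bool"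
  where "almost_invariant a H r U \<longleftrightarrow> (\<forall>h\<in>H. real (card {u \<in> U. a h u \<notin> U}) \<le> r)"

definition good_point ::
  "('g \<Rightarrow> 'g \<Rightarrow> 'g) \<Rightarrow> 'g set \<Rightarrow> 'g set \<Rightarrow> ('g \<Rightarrow> 'a \<Rightarrow> 'a) \<Rightarrow> 'a \<Rightarrow> bool"
  where "good_point mul H F a x \<longleftrightarrow> inj_on (\<lambda>g. a g x) F \<and>
    (\<forall>h\<in>H. \<forall>g\<in>F. mul h g \<in> F \<longrightarrow> a h (a g x) = a (mul h g) x)"

text \<open>At a good point a translate leaves the tile only where \<open>mul h g\<close> leaves
  \<open>F\<close>, so boundary counts simply add up.\<close>

lemma almost_invariant_tile:
  fixes r q :: real
  assumes fin: "finite U" "finite F" and inv: "almost_invariant a H r U"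
    and good: "good_point mul H F a x"
    and foln: "almost_invariant mul H q F"
  shows "almost_invariant a H (r + q) (U \<union> (\<lambda>g. a g x) ` F)"
  unfolding almost_invariant_def
proof
  fix h assume h: "h \<in> H"
  let ?f = "\<lambda>g. a g x"
  have "{u \<in> U \<union> ?f ` F. a h u \<notin> U \<union> ?f ` F} \<subseteq> {u \<in> U. a h u \<notin> U} \<union> ?f ` {g \<in> F. mul h g \<notin> F}"
    using good h unfolding good_point_def by auto
  then have "card {u \<in> U \<union> ?f ` F. a h u \<notin> U \<union> ?f ` F}
      \<le> card ({u \<in> U. a h u \<notin> U} \<union> ?f ` {g \<in> F. mul h g \<notin> F})"
    using fin by (intro card_mono) auto
  also have "\<dots> \<le> card {u \<in> U. a h u \<notin> U} + card (?f ` {g \<in> F. mul h g \<notin> F})"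
    by (rule card_Un_le)
  also have "\<dots> \<le> card {u \<in> U. a h u \<notin> U} + card {g \<in> F. mul h g \<notin> F}"
    using fin by (simp add: card_image_le)
  finally show "card {u \<in> U \<union> ?f ` F. a h u \<notin> U \<union> ?f ` F} \<le> r + q"
    using inv foln h unfolding almost_invariant_def by fastforce
qed

text \<open>The matching sends \<open>a g x\<close> to \<open>b g y\<close> for those
  \<open>g\<close> at which both points are new. Each space loses at most \<epsilon> card F
  elements, so at least half of \<open>F\<close> survives. Intertwining fails on the new points only
  at the boundary of \<open>F\<close> or where \<open>mul s g\<close> is a lost element: at most 3
  \<epsilon> card F cases, hence at most 6 \<epsilon> times the number of points gained. This is the
  origin of the factors 2 and 6 in \<open>partial_conjugacy\<close>.\<close>

lemma partial_conjugacy_add_tile: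
  fixes \<epsilon> :: real
  assumes eps: "0 < \<epsilon>" "\<epsilon> \<le> 1/4"
    and fin: "finite U" "finite V" "finite F" "F \<noteq> {}"
    and pc: "partial_conjugacy \<epsilon> S a b U V D \<sigma>"
    and good: "good_point mul S F a x" "good_point mul S F b y"
    and foln: "almost_invariant mul S (\<epsilon> * card F) F"
    and inj: "\<And>s. s \<in> S \<Longrightarrow> inj_on (mul s) F"
    and free: "card {g \<in> F. a g x \<in> U} \<le> \<epsilon> * card F" "card {g \<in> F. b g y \<in> V} \<le> \<epsilon> * card F"
  shows "\<exists>D' \<sigma>'. partial_conjugacy \<epsilon> S a b (U \<union> (\<lambda>g. a g x) ` F) (V \<union> (\<lambda>g. b g y) ` F) D' \<sigma>' \<and>
     card D' \<ge> card D + card F / 2 \<and> card D < card D'"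
proof -
  let ?f = "\<lambda>g. a g x" and ?h = "\<lambda>g. b g y"
  define F' where "F' = {g \<in> F. ?f g \<notin> U \<and> ?h g \<notin> V}"
  define \<sigma>' where "\<sigma>' d = (if d \<in> ?f ` F' then ?h (the_inv_into F ?f d) else \<sigma> d)" for d
  let ?D = "D \<union> ?f ` F'"
  have D: "D \<subseteq> U" "\<sigma> ` D \<subseteq> V" "inj_on \<sigma> D" using pc unfolding partial_conjugacy_def by auto
  have injf: "inj_on ?f F" and injh: "inj_on ?h F" using good by (auto simp: good_point_def)
  have F'F: "F' \<subseteq> F" and finF': "finite F'" using fin by (auto simp: F'_def)
  have finD: "finite D" using D fin finite_subset by blast
  have sig_new: "\<sigma>' (?f g) = ?h g" if "g \<in> F'" for g
    using that F'F by (auto simp: \<sigma>'_def the_inv_into_f_f[OF injf] subset_iff)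
  have sig_old: "\<sigma>' d = \<sigma> d" if "d \<in> D" for d
    using that D by (auto simp: \<sigma>'_def F'_def)
  have disj: "D \<inter> ?f ` F' = {}" using D by (auto simp: F'_def)
  have inj_f': "inj_on ?f F'" using injf F'F inj_on_subset by blast
  have cardD: "card ?D = card D + card F'"
    using disj finD finF' by (simp add: card_Un_disjoint card_image[OF inj_f'])
  have "F - F' = {g \<in> F. ?f g \<in> U} \<union> {g \<in> F. ?h g \<in> V}" by (auto simp: F'_def)
  then have "card (F - F') \<le> card {g \<in> F. ?f g \<in> U} + card {g \<in> F. ?h g \<in> V}"
    by (simp add: card_Un_le)
  then have cFF': "card (F - F') \<le> 2 * \<epsilon> * card F" using free by linarith
  have "card F = card F' + card (F - F')"
    using F'F fin by (metis card_Diff_subset card_mono finF' le_add_diff_inverse)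
  then have cF': "(1 - 2 * \<epsilon>) * card F \<le> card F'"
    using cFF' by (simp add: algebra_simps)
  have Fpos: "0 < card F" using fin by (simp add: card_gt_0_iff)
  have "(1/2) * real (card F) \<le> (1 - 2 * \<epsilon>) * card F"
    using eps by (intro mult_right_mono) auto
  then have cF'2: "card F / 2 \<le> card F'" using cF' by simp
  have pc': "partial_conjugacy \<epsilon> S a b (U \<union> ?f ` F) (V \<union> ?h ` F) ?D \<sigma>'"
    unfolding partial_conjugacy_def
  proof (intro conjI ballI)
    show "?D \<subseteq> U \<union> ?f ` F" using D F'F by auto
    show "\<sigma>' ` ?D \<subseteq> V \<union> ?h ` F"
      using D F'F sig_new sig_old by (auto simp: image_subset_iff)
    have "inj_on \<sigma>' D" using D(3) sig_old by (simp add: inj_on_def)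
    moreover have "inj_on \<sigma>' (?f ` F')"
      using sig_new injh F'F by (auto simp: inj_on_def subset_iff)
    moreover have "\<sigma>' ` D \<inter> \<sigma>' ` (?f ` F') = {}"
      using sig_new sig_old D(2) by (auto simp: F'_def)
    ultimately show "inj_on \<sigma>' ?D"
      using disj by (auto simp: inj_on_Un)
    have "card (U \<union> ?f ` F) \<le> card U + card F" "card (V \<union> ?h ` F) \<le> card V + card F"
      using card_Un_le card_image_le[OF fin(3)] by (metis add_left_mono le_trans)+
    then have "(1 - 2 * \<epsilon>) * card (U \<union> ?f ` F) \<le> (1 - 2 * \<epsilon>) * (real (card U) + card F)"
      "(1 - 2 * \<epsilon>) * card (V \<union> ?h ` F) \<le> (1 - 2 * \<epsilon>) * (real (card V) + card F)"
      using eps by (intro mult_left_mono; simp)+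
    then show "(1 - 2 * \<epsilon>) * card (U \<union> ?f ` F) \<le> card ?D" "(1 - 2 * \<epsilon>) * card (V \<union> ?h ` F) \<le> card ?D"
      using pc cF' cardD unfolding partial_conjugacy_def by (simp_all add: algebra_simps)
  next
    fix s assume s: "s \<in> S"
    let ?bad = "\<lambda>D \<sigma>. {d \<in> D. a s d \<notin> D \<or> \<sigma> (a s d) \<noteq> b s (\<sigma> d)}"
    let ?E = "{g \<in> F. mul s g \<notin> F} \<union> {g \<in> F. mul s g \<in> F - F'}"
    have "?bad ?D \<sigma>' \<subseteq> ?bad D \<sigma> \<union> ?f ` ?E"
    proof
      fix d assume d: "d \<in> ?bad ?D \<sigma>'"
      show "d \<in> ?bad D \<sigma> \<union> ?f ` ?E"
      proof (cases "d \<in> D")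
        case True
        then show ?thesis using d sig_old by auto
      next
        case False
        then obtain g where g: "g \<in> F'" "d = ?f g" using d by auto
        have "mul s g \<notin> F'"
        proof
          assume sg: "mul s g \<in> F'"
          have "a s (?f g) = ?f (mul s g)" "b s (?h g) = ?h (mul s g)"
            using good s g sg F'F unfolding good_point_def by blast+
          then have "a s d = ?f (mul s g)" "\<sigma>' (a s d) = b s (\<sigma>' d)"
            using g sg sig_new by auto
          then show False using d sg by auto
        qed
        then show ?thesis using g F'F by auto
      qed
    qed
    then have "card (?bad ?D \<sigma>') \<le> card (?bad D \<sigma> \<union> ?f ` ?E)"
      using finD fin by (intro card_mono) auto
    also have "\<dots> \<le> card (?bad D \<sigma>) + card (?f ` ?E)" by (rule card_Un_le)
    also have "\<dots> \<le> card (?bad D \<sigma>) + card ?E" using fin by (simp add: card_image_le)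
    also have "\<dots> \<le> card (?bad D \<sigma>) + (card {g \<in> F. mul s g \<notin> F} + card {g \<in> F. mul s g \<in> F - F'})"
      by (simp add: card_Un_le)
    finally have 1: "card (?bad ?D \<sigma>') \<le> card (?bad D \<sigma>) + (card {g \<in> F. mul s g \<notin> F} + card {g \<in> F. mul s g \<in> F - F'})" .
    have "card {g \<in> F. mul s g \<in> F - F'} \<le> card (F - F')"
      using inj[OF s] fin by (intro card_inj_on_le[of "mul s"]) (auto simp: inj_on_def)
    moreover have "card {g \<in> F. mul s g \<notin> F} \<le> \<epsilon> * card F"
      using foln s by (auto simp: almost_invariant_def)
    moreover have "card (?bad D \<sigma>) \<le> 6 * \<epsilon> * card D"
      using pc s by (auto simp: partial_conjugacy_def)
    ultimately have "card (?bad ?D \<sigma>') \<le> 6 * \<epsilon> * card D + 3 * \<epsilon> * card F"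
      using 1 cFF' by linarith
    also have "\<dots> \<le> 6 * \<epsilon> * card D + 6 * \<epsilon> * card F'"
      using cF'2 eps by simp
    finally show "card (?bad ?D \<sigma>') \<le> 6 * \<epsilon> * card ?D"
      by (simp add: cardD algebra_simps)
  qed
  have "card F' > 0" using cF'2 Fpos by linarith
  then show ?thesis using pc' cardD cF'2 by (intro exI[of _ ?D] exI[of _ \<sigma>']) auto
qed

text \<open>The preimage of \<open>U\<close> under a permutation has as many points as
  \<open>U\<close>. Thus almost invariance of \<open>U\<close>, which counts departures, also bounds
  the outside points whose image falls into \<open>U\<close>.\<close>

lemma card_entering_eq_card_leaving:
  assumes "finite X" "bij_betw f X X" "U \<subseteq> X"
  shows "card {x \<in> X - U. f x \<in> U} = card {u \<in> U. f u \<notin> U}"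
proof -
  have finU: "finite U" using assms finite_subset by blast
  have "f ` {x \<in> X. f x \<in> U} = U"
    using assms by (auto simp: bij_betw_def)
  then have "card {x \<in> X. f x \<in> U} = card U"
    using assms by (metis (no_types, lifting) bij_betw_def card_image inj_on_subset mem_Collect_eq subsetI)
  moreover have "{x \<in> X. f x \<in> U} = {x \<in> X - U. f x \<in> U} \<union> {u \<in> U. f u \<in> U}"
    using assms by auto
  moreover have "card ({x \<in> X - U. f x \<in> U} \<union> {u \<in> U. f u \<in> U})
      = card {x \<in> X - U. f x \<in> U} + card {u \<in> U. f u \<in> U}"
    using assms finU by (intro card_Un_disjoint) auto
  moreover have "card ({u \<in> U. f u \<in> U} \<union> {u \<in> U. f u \<notin> U}) = card {u \<in> U. f u \<in> U} + card {u \<in> U. f u \<notin> U}"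
    using finU by (intro card_Un_disjoint) auto
  moreover have "{u \<in> U. f u \<in> U} \<union> {u \<in> U. f u \<notin> U} = U" by auto
  ultimately show ?thesis by simp
qed

text \<open>Double counting of the incidences between the free translates of \<open>F\<close> and the part of \<open>U\<close> covered
  after \<open>U0\<close>; approximate invariance of \<open>U0\<close> ensures that most translates avoid \<open>U0\<close>.\<close>

lemma exists_free_tile:
  fixes \<epsilon> n :: real
  assumes eps: "0 < \<epsilon>"
    and fin: "finite X" "finite F" "F \<noteq> {}" and n: "real (card X) = n"
    and bij: "\<And>g. g \<in> F \<Longrightarrow> bij_betw (a g) X X"
    and U: "U0 \<subseteq> U" "U \<subseteq> X" "card U < (1 - \<epsilon>) * n"
    and inv: "almost_invariant a F (\<epsilon> / (4 * card F) * n) U0"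
    and bad: "card {x \<in> X. \<not> good x} \<le> \<epsilon> / 4 * n"
    and small: "card (U - U0) < \<epsilon>\<^sup>2 / 2 * n"
  shows "\<exists>x\<in>X. good x \<and> card {g \<in> F. a g x \<in> U} \<le> \<epsilon> * card F"
proof (rule ccontr)
  assume "\<not> ?thesis"
  then have many: "\<epsilon> * card F \<le> card {g \<in> F. a g x \<in> U}" if "x \<in> X" "good x" for x
    using that by fastforce
  \<comment> \<open>On \<open>T\<close> every incidence with \<open>U\<close> is an incidence with
    the small set \<open>U - U0\<close>.\<close>
  define T where "T = {x \<in> X. good x \<and> x \<notin> U0 \<and> (\<forall>g\<in>F. a g x \<notin> U0)}"
  have finT: "finite T" and finU: "finite U" using fin U finite_subset by (auto simp: T_def)
  have finU0: "finite U0" using finU U finite_subset by blast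
  have Fpos: "0 < real (card F)" using fin by (simp add: card_gt_0_iff)
  let ?E = "\<lambda>g. {x \<in> X - U0. a g x \<in> U0}"
  have "real (card (?E g)) \<le> \<epsilon> / (4 * card F) * n" if "g \<in> F" for g
    using card_entering_eq_card_leaving[OF fin(1) bij[OF that], of U0] U inv that
    by (auto simp: almost_invariant_def)
  then have "(\<Sum>g\<in>F. real (card (?E g))) \<le> (\<Sum>g\<in>F. \<epsilon> / (4 * card F) * n)"
    by (intro sum_mono)
  also have "\<dots> = \<epsilon> / 4 * n" using Fpos by simp
  finally have sumE: "(\<Sum>g\<in>F. real (card (?E g))) \<le> \<epsilon> / 4 * n" .
  have "X \<subseteq> T \<union> {x \<in> X. \<not> good x} \<union> U0 \<union> (\<Union>g\<in>F. ?E g)"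
    by (auto simp: T_def)
  then have "card X \<le> card (T \<union> {x \<in> X. \<not> good x} \<union> U0 \<union> (\<Union>g\<in>F. ?E g))"
    using fin finT finU0 by (intro card_mono) auto
  also have "\<dots> \<le> card (T \<union> {x \<in> X. \<not> good x} \<union> U0) + card (\<Union>g\<in>F. ?E g)" by (rule card_Un_le)
  also have "card (T \<union> {x \<in> X. \<not> good x} \<union> U0) \<le> card (T \<union> {x \<in> X. \<not> good x}) + card U0" by (rule card_Un_le)
  also have "card (T \<union> {x \<in> X. \<not> good x}) \<le> card T + card {x \<in> X. \<not> good x}" by (rule card_Un_le)
  also have "card (\<Union>g\<in>F. ?E g) \<le> (\<Sum>g\<in>F. card (?E g))" by (rule card_UN_le[OF fin(2)])
  finally have "card X \<le> card T + card {x \<in> X. \<not> good x} + card U0 + (\<Sum>g\<in>F. card (?E g))" by simp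
  then have "real (card X) \<le> real (card T + card {x \<in> X. \<not> good x} + card U0 + (\<Sum>g\<in>F. card (?E g)))"
    by (simp only: of_nat_le_iff)
  then have "n \<le> real (card T) + card {x \<in> X. \<not> good x} + card U0 + (\<Sum>g\<in>F. real (card (?E g)))"
    using n by simp
  moreover have "real (card U0) \<le> card U" using U finU by (simp add: card_mono)
  \<comment> \<open>More than \<epsilon> n points lie outside \<open>U\<close>; the points that are
    not good and those entering \<open>U0\<close> cost at most \<epsilon> n / 4 each. With at least
    \<epsilon> card F incidences per point of \<open>T\<close>, this produces the threshold
    \<epsilon>^2 n / 2.\<close>
  ultimately have "\<epsilon> / 2 * n \<le> card T"
    using sumE bad U(3) by (simp add: algebra_simps)
  then have "\<epsilon> * card F * (\<epsilon> / 2 * n) \<le> \<epsilon> * card F * card T"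
    using eps by (intro mult_left_mono) auto
  also have "\<dots> = (\<Sum>x\<in>T. \<epsilon> * card F)" by simp
  also have "\<dots> \<le> (\<Sum>x\<in>T. real (card {g \<in> F. a g x \<in> U}))"
    using many by (intro sum_mono) (auto simp: T_def)
  also have "\<dots> = real (\<Sum>x\<in>T. card {g \<in> F. a g x \<in> U})" by simp
  also have "(\<Sum>x\<in>T. card {g \<in> F. a g x \<in> U}) = (\<Sum>g\<in>F. card {x \<in> T. a g x \<in> U})"
    using sum_multicount_gen[OF finT fin(2), of "\<lambda>x g. a g x \<in> U" "\<lambda>g. card {x \<in> T. a g x \<in> U}"] by simp
  also have "\<dots> \<le> (\<Sum>g\<in>F. card (U - U0))"
  proof (intro sum_mono)
    fix g assume g: "g \<in> F"
    have "inj_on (a g) {x \<in> T. a g x \<in> U}"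
      using bij[OF g] by (auto simp: bij_betw_def T_def inj_on_def)
    then show "card {x \<in> T. a g x \<in> U} \<le> card (U - U0)"
      using g finU by (intro card_inj_on_le[of "a g"]) (auto simp: T_def)
  qed
  finally have "card F * (\<epsilon>\<^sup>2 / 2 * n) \<le> card F * card (U - U0)"
    by (simp add: power2_eq_square algebra_simps)
  then show False using small Fpos by simp
qed

text \<open>Among the states extending the given one, take one with card D maximal. A further pair
  of tiles would enlarge \<open>D\<close>, so the hypotheses of \<open>exists_free_tile\<close> must
  fail in one of the two spaces. The factor 2 in 2 \<eta> card D appears because a tile adds \<eta>
  card F to the boundary but perhaps only card F / 2 points to \<open>D\<close>.\<close>

lemma partial_conjugacy_extend:
  fixes \<epsilon> \<eta> n :: real
  assumes eps: "0 < \<epsilon>" "\<epsilon> \<le> 1/4" and eta: "0 \<le> \<eta>"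
    and fin: "finite X" "finite Y" "finite F" "F \<noteq> {}" and n: "real (card X) = n" "real (card Y) = n"
    and bij: "\<And>g. bij_betw (a g) X X" "\<And>g. bij_betw (b g) Y Y"
    and foln: "almost_invariant mul S (\<epsilon> * card F) F" "almost_invariant mul H (\<eta> * card F) F"
    and inj: "\<And>s. s \<in> S \<Longrightarrow> inj_on (mul s) F"
    and pc: "partial_conjugacy \<epsilon> S a b U0 V0 D0 \<sigma>0" "U0 \<subseteq> X" "V0 \<subseteq> Y"
    and invH: "almost_invariant a H (2 * \<eta> * card D0) U0" "almost_invariant b H (2 * \<eta> * card D0) V0"
    and invF: "almost_invariant a F (\<epsilon> / (4 * card F) * n) U0" "almost_invariant b F (\<epsilon> / (4 * card F) * n) V0"
    and bad: "card {x \<in> X. \<not> good_point mul (H \<union> S) F a x} \<le> \<epsilon> / 4 * n"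
      "card {y \<in> Y. \<not> good_point mul (H \<union> S) F b y} \<le> \<epsilon> / 4 * n"
  shows "\<exists>U V D \<sigma>. partial_conjugacy \<epsilon> S a b U V D \<sigma> \<and> U \<subseteq> X \<and> V \<subseteq> Y \<and>
    almost_invariant a H (2 * \<eta> * card D) U \<and> almost_invariant b H (2 * \<eta> * card D) V \<and>
    (card U \<ge> (1 - \<epsilon>) * n \<or> card V \<ge> (1 - \<epsilon>) * n \<or>
     real (card U) + card V \<ge> real (card U0) + card V0 + \<epsilon>\<^sup>2 / 2 * n)"
proof -
  define P where "P = (\<lambda>(U, V, D, \<sigma>). partial_conjugacy \<epsilon> S a b U V D \<sigma> \<and> U \<subseteq> X \<and> V \<subseteq> Y \<and>
    almost_invariant a H (2 * \<eta> * card D) U \<and> almost_invariant b H (2 * \<eta> * card D) V \<and> U0 \<subseteq> U \<and> V0 \<subseteq> V)"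
  have "P (U0, V0, D0, \<sigma>0)" using pc invH by (simp add: P_def)
  moreover have "\<forall>st. P st \<longrightarrow> card (fst (snd (snd st))) < Suc (card X)"
    using fin(1) by (auto simp: P_def partial_conjugacy_def less_Suc_eq_le intro!: card_mono)
  ultimately obtain st where st: "P st" "\<And>st'. P st' \<Longrightarrow> card (fst (snd (snd st'))) \<le> card (fst (snd (snd st)))"
    using ex_has_greatest_nat[of P _ "\<lambda>st. card (fst (snd (snd st)))" "Suc (card X)"] by blast
  obtain U V D \<sigma> where st_eq: "st = (U, V, D, \<sigma>)" by (cases st) auto
  have P: "partial_conjugacy \<epsilon> S a b U V D \<sigma>" "U \<subseteq> X" "V \<subseteq> Y"
    "almost_invariant a H (2 * \<eta> * card D) U" "almost_invariant b H (2 * \<eta> * card D) V" "U0 \<subseteq> U" "V0 \<subseteq> V"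
    using st(1) by (simp_all add: P_def st_eq)
  have finUV: "finite U" "finite V" using P fin finite_subset by blast+
  have "False" if neg: "card U < (1 - \<epsilon>) * n" "card V < (1 - \<epsilon>) * n"
     "real (card U) + card V < real (card U0) + card V0 + \<epsilon>\<^sup>2 / 2 * n"
  proof -
    have "real (card U) = card U0 + card (U - U0)" "real (card V) = card V0 + card (V - V0)"
      using P finUV by (metis card_Diff_subset card_mono finite_subset le_add_diff_inverse of_nat_add)+
    then have small: "card (U - U0) < \<epsilon>\<^sup>2 / 2 * n" "card (V - V0) < \<epsilon>\<^sup>2 / 2 * n" using neg by linarith+
    obtain x where x: "x \<in> X" "good_point mul (H \<union> S) F a x" "card {g \<in> F. a g x \<in> U} \<le> \<epsilon> * card F"
      using exists_free_tile[OF eps(1) fin(1,3,4) n(1) bij(1) P(6,2) neg(1) invF(1) bad(1) small(1)] by blast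
    obtain y where y: "y \<in> Y" "good_point mul (H \<union> S) F b y" "card {g \<in> F. b g y \<in> V} \<le> \<epsilon> * card F"
      using exists_free_tile[OF eps(1) fin(2,3,4) n(2) bij(2) P(7,3) neg(2) invF(2) bad(2) small(2)] by blast
    have good: "good_point mul S F a x" "good_point mul S F b y" "good_point mul H F a x" "good_point mul H F b y"
      using x(2) y(2) by (auto simp: good_point_def)
    let ?U = "U \<union> (\<lambda>g. a g x) ` F" and ?V = "V \<union> (\<lambda>g. b g y) ` F"
    obtain D' \<sigma>' where D': "partial_conjugacy \<epsilon> S a b ?U ?V D' \<sigma>'"
      "card D' \<ge> card D + card F / 2" "card D < card D'"
      using partial_conjugacy_add_tile[OF eps finUV fin(3,4) P(1) good(1,2) foln(1) inj x(3) y(3)] by auto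
    have "2 * \<eta> * (card D + card F / 2) \<le> 2 * \<eta> * card D'"
      using D'(2) eta by (intro mult_left_mono) auto
    then have le: "2 * \<eta> * card D + \<eta> * card F \<le> 2 * \<eta> * card D'" by (simp add: algebra_simps)
    have "almost_invariant a H (2 * \<eta> * card D') ?U"
      using almost_invariant_tile[OF finUV(1) fin(3) P(4) good(3) foln(2)] le
      by (force simp: almost_invariant_def)
    moreover have "almost_invariant b H (2 * \<eta> * card D') ?V"
      using almost_invariant_tile[OF finUV(2) fin(3) P(5) good(4) foln(2)] le
      by (force simp: almost_invariant_def)
    moreover have "(\<lambda>g. a g x) ` F \<subseteq> X" "(\<lambda>g. b g y) ` F \<subseteq> Y"
      using bij[THEN bij_betwE] x(1) y(1) by auto
    ultimately have "P (?U, ?V, D', \<sigma>')"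
      using D'(1) P by (auto simp: P_def)
    from st(2)[OF this] D'(3) show False by (simp add: st_eq)
  qed
  then show ?thesis using P by (meson not_le)
qed

text \<open>Induction on the number \<open>k\<close> of rounds, each with its own Foelner set.
  \<open>H\<close> and \<eta> vary because the last round fixes its set \<open>F\<close> first and
  then demands that the preceding rounds leave a union almost invariant under \<open>F\<close> too.
  The finite set \<open>K\<close> is chosen before the spaces, so one finite amount of almost
  freeness serves all of them.\<close>

lemma exists_partial_conjugacy:
  fixes \<epsilon> \<eta> :: real and mul :: "'g \<Rightarrow> 'g \<Rightarrow> 'g" and k :: nat
  assumes eps: "0 < \<epsilon>" "\<epsilon> \<le> 1/4"
    and foelner: "\<And>H (\<eta>::real). finite H \<Longrightarrow> 0 < \<eta> \<Longrightarrow>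
        \<exists>F. finite F \<and> F \<noteq> {} \<and> almost_invariant mul H (\<eta> * card F) F"
    and inj: "\<And>s. inj (mul s)" and S: "finite S"
  assumes "finite H" "0 < \<eta>"
  shows "\<exists>K. finite K \<and> (\<forall>X Y a b. finite X \<longrightarrow> finite Y \<longrightarrow> card X = card Y \<longrightarrow>
    (\<forall>g. bij_betw (a g) X X) \<longrightarrow> (\<forall>g. bij_betw (b g) Y Y) \<longrightarrow>
    card {x \<in> X. \<not> good_point mul K K a x} \<le> \<epsilon> / 4 * card X \<longrightarrow>
    card {y \<in> Y. \<not> good_point mul K K b y} \<le> \<epsilon> / 4 * card X \<longrightarrow>
    (\<exists>U V D \<sigma>. partial_conjugacy \<epsilon> S a (b :: 'g \<Rightarrow> 'b \<Rightarrow> 'b) U V D \<sigma> \<and> (U :: 'a set) \<subseteq> X \<and> V \<subseteq> Y \<and>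
    almost_invariant a H (\<eta> * card D) U \<and> almost_invariant b H (\<eta> * card D) V \<and>
    (card U \<ge> (1 - \<epsilon>) * card X \<or> card V \<ge> (1 - \<epsilon>) * card X \<or>
     real (card U) + card V \<ge> k * (\<epsilon>\<^sup>2 / 2 * card X))))"
  using assms(6,7)
proof (induction k arbitrary: H \<eta>)
  case 0
  show ?case
  proof (rule exI[of _ "{}"], intro conjI allI impI)
    fix X :: "'a set" and Y :: "'b set" and a b
    show "\<exists>U V D \<sigma>. partial_conjugacy \<epsilon> S a (b :: 'g \<Rightarrow> 'b \<Rightarrow> 'b) U V D \<sigma> \<and> U \<subseteq> X \<and> V \<subseteq> Y \<and>
    almost_invariant a H (\<eta> * card D) U \<and> almost_invariant b H (\<eta> * card D) V \<and>
    (card U \<ge> (1 - \<epsilon>) * card X \<or> card V \<ge> (1 - \<epsilon>) * card X \<or>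
     real (card U) + card V \<ge> (0::nat) * (\<epsilon>\<^sup>2 / 2 * card X))"
      by (intro exI[of _ "{}"] exI[of _ "undefined"]) (simp add: partial_conjugacy_def almost_invariant_def)
  qed simp
next
  case (Suc k)
  \<comment> \<open>Half of \<eta> pays for the factor 2 of \<open>partial_conjugacy_extend\<close>;
    the bound by \<epsilon> makes the same \<open>F\<close> invariant enough under
    \<open>S\<close>.\<close>
  define \<eta>1 where "\<eta>1 = min (\<eta> / 2) \<epsilon>"
  have eta1: "0 < \<eta>1" "\<eta>1 \<le> \<epsilon>" "2 * \<eta>1 \<le> \<eta>" using Suc.prems eps by (auto simp: \<eta>1_def)
  obtain F where F: "finite F" "F \<noteq> {}" "almost_invariant mul (H \<union> S) (\<eta>1 * card F) F"
    using foelner[of "H \<union> S" \<eta>1] Suc.prems S eta1 by auto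
  have Fpos: "0 < real (card F)" using F by (simp add: card_gt_0_iff)
  \<comment> \<open>The first bound starts the new round within its own boundary allowance, the
    second is the invariance under \<open>F\<close> that \<open>exists_free_tile\<close>
    requires.\<close>
  define \<eta>2 where "\<eta>2 = min (2 * \<eta>1) (\<epsilon> / (4 * card F))"
  have eta2: "0 < \<eta>2" using eta1 eps Fpos by (simp add: \<eta>2_def)
  have "finite (H \<union> F)" using Suc.prems F by simp
  from Suc.IH[OF this eta2] obtain K where K: "finite K" and KP:
    "\<And>X Y a b. finite X \<Longrightarrow> finite Y \<Longrightarrow> card X = card Y \<Longrightarrow>
    (\<forall>g. bij_betw (a g) X X) \<Longrightarrow> (\<forall>g. bij_betw (b g) Y Y) \<Longrightarrow>
    card {x \<in> X. \<not> good_point mul K K a x} \<le> \<epsilon> / 4 * card X \<Longrightarrow>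
    card {y \<in> Y. \<not> good_point mul K K b y} \<le> \<epsilon> / 4 * card X \<Longrightarrow>
    (\<exists>U V D \<sigma>. partial_conjugacy \<epsilon> S a (b :: 'g \<Rightarrow> 'b \<Rightarrow> 'b) U V D \<sigma> \<and> (U :: 'a set) \<subseteq> X \<and> V \<subseteq> Y \<and>
    almost_invariant a (H \<union> F) (\<eta>2 * card D) U \<and> almost_invariant b (H \<union> F) (\<eta>2 * card D) V \<and>
    (card U \<ge> (1 - \<epsilon>) * card X \<or> card V \<ge> (1 - \<epsilon>) * card X \<or>
     real (card U) + card V \<ge> k * (\<epsilon>\<^sup>2 / 2 * card X)))" by blast
  define K' where "K' = K \<union> F \<union> H \<union> S"
  have K': "finite K'" using K F Suc.prems S by (simp add: K'_def)
  show ?case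
  proof (intro exI[of _ K'] conjI allI impI K')
    fix X :: "'a set" and Y :: "'b set" and a b
    assume fin: "finite X" "finite Y" and card: "card X = card Y"
      and bij: "\<forall>g. bij_betw (a g) X X" "\<forall>g. bij_betw (b g) Y Y"
      and bad: "card {x \<in> X. \<not> good_point mul K' K' a x} \<le> \<epsilon> / 4 * card X"
        "card {y \<in> Y. \<not> good_point mul K' K' b y} \<le> \<epsilon> / 4 * card X"
    have sub: "card {x \<in> Z. \<not> good_point mul H' F' c x} \<le> \<epsilon> / 4 * card X"
      if "card {x \<in> Z. \<not> good_point mul K' K' c x} \<le> \<epsilon> / 4 * card X" "finite Z" "H' \<subseteq> K'" "F' \<subseteq> K'"
      for Z :: "'z set" and H' F' and c :: "'g \<Rightarrow> 'z \<Rightarrow> 'z"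
    proof -
      have "good_point mul H' F' c x" if "good_point mul K' K' c x" for x
        using that \<open>H' \<subseteq> K'\<close> \<open>F' \<subseteq> K'\<close> by (auto simp: good_point_def inj_on_def subset_iff)
      then have "card {x \<in> Z. \<not> good_point mul H' F' c x} \<le> card {x \<in> Z. \<not> good_point mul K' K' c x}"
        using that by (intro card_mono) auto
      then show ?thesis using that(1) by linarith
    qed
    have "K \<subseteq> K'" by (auto simp: K'_def)
    then obtain U0 V0 D0 \<sigma>0 where st: "partial_conjugacy \<epsilon> S a b U0 V0 D0 \<sigma>0" "U0 \<subseteq> X" "V0 \<subseteq> Y"
      "almost_invariant a (H \<union> F) (\<eta>2 * card D0) U0" "almost_invariant b (H \<union> F) (\<eta>2 * card D0) V0"
      and alt: "card U0 \<ge> (1 - \<epsilon>) * card X \<or> card V0 \<ge> (1 - \<epsilon>) * card X \<or>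
       real (card U0) + card V0 \<ge> k * (\<epsilon>\<^sup>2 / 2 * card X)"
      using KP[OF fin card bij sub[OF bad(1) fin(1)] sub[OF bad(2) fin(2)]] by blast
    have D0: "card D0 \<le> card X"
      using st(1,2) fin by (intro card_mono) (auto simp: partial_conjugacy_def)
    have "\<eta>2 * card D0 \<le> 2 * \<eta>1 * card D0" by (intro mult_right_mono) (auto simp: \<eta>2_def)
    then have invH: "almost_invariant a H (2 * \<eta>1 * card D0) U0" "almost_invariant b H (2 * \<eta>1 * card D0) V0"
      using st(4,5) by (force simp: almost_invariant_def)+
    have "\<eta>2 * card D0 \<le> \<epsilon> / (4 * card F) * card X"
      using D0 eps by (intro mult_mono) (auto simp: \<eta>2_def)
    then have invF: "almost_invariant a F (\<epsilon> / (4 * card F) * card X) U0" "almost_invariant b F (\<epsilon> / (4 * card F) * card X) V0"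
      using st(4,5) by (force simp: almost_invariant_def)+
    have "\<eta>1 * card F \<le> \<epsilon> * card F" using eta1 by (intro mult_right_mono) auto
    then have foln: "almost_invariant mul S (\<epsilon> * card F) F" "almost_invariant mul H (\<eta>1 * card F) F"
      using F(3) by (force simp: almost_invariant_def)+
    have HS: "H \<union> S \<subseteq> K'" "F \<subseteq> K'" by (auto simp: K'_def)
    have cardY: "real (card Y) = real (card X)" using card by simp
    obtain U V D \<sigma> where new: "partial_conjugacy \<epsilon> S a b U V D \<sigma>" "U \<subseteq> X" "V \<subseteq> Y"
      "almost_invariant a H (2 * \<eta>1 * card D) U" "almost_invariant b H (2 * \<eta>1 * card D) V"
      "card U \<ge> (1 - \<epsilon>) * card X \<or> card V \<ge> (1 - \<epsilon>) * card X \<or>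
       real (card U) + card V \<ge> real (card U0) + card V0 + \<epsilon>\<^sup>2 / 2 * card X"
      using partial_conjugacy_extend[OF eps less_imp_le[OF eta1(1)] fin F(1,2) HOL.refl cardY
          bij[rule_format] foln inj_on_subset[OF inj subset_UNIV] st(1-3) invH invF
          sub[OF bad(1) fin(1) HS] sub[OF bad(2) fin(2) HS]] by blast
    have "2 * \<eta>1 * card D \<le> \<eta> * card D" using eta1 by (intro mult_right_mono) auto
    then have inv: "almost_invariant a H (\<eta> * card D) U" "almost_invariant b H (\<eta> * card D) V"
      using new(4,5) by (force simp: almost_invariant_def)+
    show "\<exists>U V D \<sigma>. partial_conjugacy \<epsilon> S a (b :: 'g \<Rightarrow> 'b \<Rightarrow> 'b) U V D \<sigma> \<and> (U :: 'a set) \<subseteq> X \<and> V \<subseteq> Y \<and>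
    almost_invariant a H (\<eta> * card D) U \<and> almost_invariant b H (\<eta> * card D) V \<and>
    (card U \<ge> (1 - \<epsilon>) * card X \<or> card V \<ge> (1 - \<epsilon>) * card X \<or>
     real (card U) + card V \<ge> Suc k * (\<epsilon>\<^sup>2 / 2 * card X))"
    proof (cases "card U0 \<ge> (1 - \<epsilon>) * card X \<or> card V0 \<ge> (1 - \<epsilon>) * card X")
      \<comment> \<open>The extension does not promise to keep this coverage, so the earlier state
        itself is returned.\<close>
      case True
      have "\<eta>2 * card D0 \<le> \<eta> * card D0" using eta1 by (intro mult_right_mono) (auto simp: \<eta>2_def)
      then have "almost_invariant a H (\<eta> * card D0) U0" "almost_invariant b H (\<eta> * card D0) V0"
        using st(4,5) by (force simp: almost_invariant_def)+
      then show ?thesis using st(1-3) True by blast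
    next
      case False
      then have "real (card U0) + card V0 \<ge> k * (\<epsilon>\<^sup>2 / 2 * card X)" using alt by blast
      then have "card U \<ge> (1 - \<epsilon>) * card X \<or> card V \<ge> (1 - \<epsilon>) * card X \<or>
        real (card U) + card V \<ge> Suc k * (\<epsilon>\<^sup>2 / 2 * card X)"
        using new(6) by (auto simp: algebra_simps)
      then show ?thesis using new(1-3) inv by blast
    qed
  qed
qed

section \<open>Almost actions of Baumslag-Solitar groups\<close>

text \<open>The pair \<open>(i, j)\<close> stands for \<open>A\<^sup>i B\<^sup>j\<close>; the relation \<open>B A = A B\<^sup>m\<close> moves \<open>B\<close> to the right.\<close>

definition bs_mult :: "nat \<Rightarrow> nat \<times> nat \<Rightarrow> nat \<times> nat \<Rightarrow> nat \<times> nat"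
  where "bs_mult m h g = (fst h + fst g, snd h * m ^ fst g + snd g)"

definition bs_act :: "('a \<Rightarrow> 'a) \<Rightarrow> ('a \<Rightarrow> 'a) \<Rightarrow> nat \<times> nat \<Rightarrow> 'a \<Rightarrow> 'a"
  where "bs_act A B g x = (A ^^ fst g) ((B ^^ snd g) x)"

lemma inj_bs_mult: "inj (bs_mult m h)"
  by (auto simp: inj_on_def bs_mult_def)

text \<open>Moving B^q past A^i turns it into a power with exponent q m^i. A rectangle therefore
  works once its B-side is long compared with m to the power of its A-side; each side contributes at
  most half of \<eta>.\<close>

lemma bs_foelner:
  fixes \<eta> :: real
  assumes "finite H" "0 < \<eta>"
  shows "\<exists>F. finite F \<and> F \<noteq> {} \<and> almost_invariant (bs_mult m) H (\<eta> * card F) F"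
proof -
  obtain M where M: "\<And>h. h \<in> H \<Longrightarrow> fst h \<le> M" "\<And>h. h \<in> H \<Longrightarrow> snd h \<le> M"
  proof
    show "fst h \<le> Max (fst ` H \<union> snd ` H)" "snd h \<le> Max (fst ` H \<union> snd ` H)" if "h \<in> H" for h
      using that assms by (auto intro!: Max_ge)
  qed
  define K where "K = Suc (nat \<lceil>2 * M / \<eta>\<rceil>)"
  \<comment> \<open>The base \<open>m + 1\<close> makes the powers monotone in the exponent for
    every \<open>m\<close>.\<close>
  define C where "C = (m + 1) ^ K"
  define J where "J = Suc (nat \<lceil>2 * (M * C) / \<eta>\<rceil>)"
  have "2 * M / \<eta> \<le> K" unfolding K_def by linarith
  then have K: "M \<le> \<eta> / 2 * K" using assms by (simp add: field_simps)
  have "2 * (M * C) / \<eta> \<le> J" unfolding J_def by linarith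
  then have J: "M * C \<le> \<eta> / 2 * J" using assms by (simp add: field_simps)
  let ?F = "{..<K} \<times> {..<J}"
  have "almost_invariant (bs_mult m) H (\<eta> * card ?F) ?F"
    unfolding almost_invariant_def
  proof
    fix h assume h: "h \<in> H"
    have bound: "snd h * m ^ i \<le> M * C" if "i < K" for i
    proof -
      have "m ^ i \<le> (m + 1) ^ i" by (intro power_mono) auto
      also have "\<dots> \<le> C" unfolding C_def using that by (intro power_increasing) auto
      finally show ?thesis using M(2)[OF h] by (intro mult_mono) auto
    qed
    have "{g \<in> ?F. bs_mult m h g \<notin> ?F} \<subseteq> {K - M..<K} \<times> {..<J} \<union> {..<K} \<times> {J - M * C..<J}"
      using M(1)[OF h] bound by (fastforce simp: bs_mult_def)
    then have "card {g \<in> ?F. bs_mult m h g \<notin> ?F} \<le> card ({K - M..<K} \<times> {..<J} \<union> {..<K} \<times> {J - M * C..<J})"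
      by (intro card_mono) auto
    also have "\<dots> \<le> card ({K - M..<K} \<times> {..<J}) + card ({..<K} \<times> {J - M * C..<J})"
      by (rule card_Un_le)
    also have "\<dots> \<le> M * J + K * (M * C)"
      unfolding card_cartesian_product by (intro add_mono mult_mono) auto
    finally have "real (card {g \<in> ?F. bs_mult m h g \<notin> ?F}) \<le> real (M * J + K * (M * C))"
      by (simp only: of_nat_le_iff)
    also have "\<dots> = real M * J + K * real (M * C)" by simp
    also have "\<dots> \<le> (\<eta> / 2 * K) * J + K * (\<eta> / 2 * J)"
      using K J by (intro add_mono mult_right_mono mult_left_mono) auto
    also have "\<dots> = \<eta> * card ?F" by (simp add: algebra_simps)
    finally show "card {g \<in> ?F. bs_mult m h g \<notin> ?F} \<le> \<eta> * card ?F" .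
  qed
  moreover have "?F \<noteq> {}" by (auto simp: K_def J_def)
  ultimately show ?thesis by (intro exI[of _ ?F]) auto
qed

section \<open>Almost actions and their almost conjugacy\<close>

definition almost_bs :: "nat \<Rightarrow> nat \<Rightarrow> real \<Rightarrow> 'a set \<Rightarrow> ('a \<Rightarrow> 'a) \<Rightarrow> ('a \<Rightarrow> 'a) \<Rightarrow> bool"
  where "almost_bs m L \<delta> X A B \<longleftrightarrow> finite X \<and> bij_betw A X X \<and> bij_betw B X X \<and>
    real (card {x \<in> X. B (A x) \<noteq> A ((B ^^ m) x)}) \<le> \<delta> * real (card X) \<and>
    (\<forall>g\<in>{..<L} \<times> {..<L}. \<forall>h\<in>{..<L} \<times> {..<L}. g \<noteq> h \<longrightarrow>
       real (card {x \<in> X. bs_act A B g x = bs_act A B h x}) \<le> \<delta> * real (card X))"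

lemma bij_betw_bs_act:
  assumes "bij_betw A X X" "bij_betw B X X"
  shows "bij_betw (bs_act A B g) X X"
proof -
  have "bs_act A B g = (A ^^ fst g) \<circ> (B ^^ snd g)" by (auto simp: bs_act_def)
  then show ?thesis using assms by (metis bij_betw_funpow bij_betw_trans)
qed

text \<open>The relation is assumed only at the points of one orbit that the rewriting visits;
  \<open>M\<close> bounds all exponents of \<open>B\<close> that occur. This makes the failures
  countable by a union bound.\<close>

lemma funpow_push_left:
  assumes "\<And>i' l. i' < i \<Longrightarrow> l < M \<Longrightarrow>
      B (A ((A ^^ i') ((B ^^ l) x))) = A ((B ^^ m) ((A ^^ i') ((B ^^ l) x)))"
    and "b * m ^ i + j < M"
  shows "(B ^^ b) ((A ^^ i) ((B ^^ j) x)) = (A ^^ i) ((B ^^ (b * m ^ i + j)) x)"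
  using assms
proof (induction i arbitrary: b)
  case 0
  then show ?case by (simp add: funpow_add)
next
  case (Suc i)
  note IH = Suc.IH and rel = Suc.prems(1)
  let ?z = "(A ^^ i) ((B ^^ j) x)"
  have step: "(B ^^ c) (A ?z) = A ((B ^^ (m * c)) ?z)" if "c \<le> b" for c
    using that
  proof (induction c)
    case (Suc c)
    have "c * m ^ Suc i \<le> b * m ^ Suc i" using Suc.prems by (intro mult_right_mono) auto
    moreover have "m * c * m ^ i = c * m ^ Suc i" by simp
    ultimately have lt: "m * c * m ^ i + j < M" using \<open>b * m ^ Suc i + j < M\<close> by linarith
    \<comment> \<open>The current point is brought back to the form A^i B^l x, the only form for
      which the relation is available.\<close>
    have eq: "(B ^^ (m * c)) ?z = (A ^^ i) ((B ^^ (m * c * m ^ i + j)) x)"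
      using Suc.prems lt by (intro IH rel) auto
    have "(B ^^ Suc c) (A ?z) = B (A ((B ^^ (m * c)) ?z))" using Suc by simp
    also have "\<dots> = A ((B ^^ m) ((B ^^ (m * c)) ?z))"
      unfolding eq using lt by (intro rel) auto
    finally show ?case by (simp add: funpow_add)
  qed simp
  have lt: "m * b * m ^ i + j < M" using Suc.prems(2) by (simp add: algebra_simps)
  have "(B ^^ b) ((A ^^ Suc i) ((B ^^ j) x)) = A ((B ^^ (m * b)) ?z)"
    using step[of b] by simp
  also have "(B ^^ (m * b)) ?z = (A ^^ i) ((B ^^ (m * b * m ^ i + j)) x)"
    using lt by (intro IH rel) auto
  finally show ?case by (simp add: algebra_simps)
qed

lemma card_vimage_bij_betw:
  assumes "bij_betw f X X" "R \<subseteq> X"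
  shows "card {x \<in> X. f x \<in> R} = card R"
proof (rule bij_betw_same_card)
  show "bij_betw f {x \<in> X. f x \<in> R} R"
    using assms by (auto simp: bij_betw_def inj_on_def)
qed

text \<open>A point is good unless two elements of the box coincide there, at most
  \<open>L ^ 4\<close> ordered pairs, or one of the \<open>L * M\<close> points visited while
  rewriting violates the relation. Each visit is a permutation, so pulling back the violations does
  not change their number.\<close>

lemma almost_bs_card_bad:
  fixes \<delta> :: real and L M :: nat
  assumes bs: "almost_bs m L \<delta> X A B" and K: "K \<subseteq> {..<L} \<times> {..<L}" and M: "M = L * (m + 1) ^ L + L"
  shows "card {x \<in> X. \<not> good_point (bs_mult m) K K (bs_act A B) x} \<le> (L ^ 4 + L * M) * (\<delta> * card X)"
proof -
  let ?a = "bs_act A B" and ?box = "{..<L} \<times> {..<L}"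
  have fin: "finite X" and bij: "bij_betw A X X" "bij_betw B X X"
    and rel: "card {x \<in> X. B (A x) \<noteq> A ((B ^^ m) x)} \<le> \<delta> * card X"
    and coin: "\<And>g h. g \<in> ?box \<Longrightarrow> h \<in> ?box \<Longrightarrow> g \<noteq> h \<Longrightarrow> card {x \<in> X. ?a g x = ?a h x} \<le> \<delta> * card X"
    using bs unfolding almost_bs_def by blast+
  define R where "R = {x \<in> X. B (A x) \<noteq> A ((B ^^ m) x)}"
  define E where "E p = {x \<in> X. fst p \<noteq> snd p \<and> ?a (fst p) x = ?a (snd p) x}" for p
  define E' where "E' g = {x \<in> X. ?a g x \<in> R}" for g
  let ?I = "?box \<times> ?box" and ?I' = "{..<L} \<times> {..<M}"
  have "{x \<in> X. \<not> good_point (bs_mult m) K K ?a x} \<subseteq> \<Union> (E ` ?I) \<union> \<Union> (E' ` ?I')"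
  proof
    fix x assume x: "x \<in> {x \<in> X. \<not> good_point (bs_mult m) K K ?a x}"
    show "x \<in> \<Union> (E ` ?I) \<union> \<Union> (E' ` ?I')"
    proof (rule ccontr)
      assume neg: "x \<notin> \<Union> (E ` ?I) \<union> \<Union> (E' ` ?I')"
      have "inj_on (\<lambda>g. ?a g x) ?box"
        using neg x unfolding inj_on_def E_def by fastforce
      then have "inj_on (\<lambda>g. ?a g x) K" using K inj_on_subset by blast
      moreover have "?a h (?a g x) = ?a (bs_mult m h g) x" if "h \<in> K" "g \<in> K" for g h
      proof -
        obtain p q where h: "h = (p, q)" by (cases h)
        obtain i j where g: "g = (i, j)" by (cases g)
        have lt: "q < L" "i < L" "j < L" using that K h g by auto
        have "m ^ i \<le> (m + 1) ^ i" by (intro power_mono) auto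
        also have "\<dots> \<le> (m + 1) ^ L" using lt by (intro power_increasing) auto
        finally have "q * m ^ i \<le> L * (m + 1) ^ L" using lt by (intro mult_mono) auto
        then have "q * m ^ i + j < M" using lt M by linarith
        moreover have "B (A ((A ^^ i') ((B ^^ l) x))) = A ((B ^^ m) ((A ^^ i') ((B ^^ l) x)))"
          if "i' < i" "l < M" for i' l
        proof -
          have "(i', l) \<in> ?I'" using that lt by auto
          then have "?a (i', l) x \<notin> R" using neg x by (auto simp: E'_def)
          moreover have "?a (i', l) x \<in> X"
            using bij_betwE[OF bij_betw_bs_act[OF bij]] x by auto
          ultimately show ?thesis by (simp add: R_def bs_act_def)
        qed
        ultimately have "(B ^^ q) ((A ^^ i) ((B ^^ j) x)) = (A ^^ i) ((B ^^ (q * m ^ i + j)) x)"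
          by (intro funpow_push_left)
        then show ?thesis by (simp add: h g bs_act_def bs_mult_def funpow_add)
      qed
      ultimately have "good_point (bs_mult m) K K ?a x" by (auto simp: good_point_def)
      then show False using x by simp
    qed
  qed
  then have "card {x \<in> X. \<not> good_point (bs_mult m) K K ?a x} \<le> card (\<Union> (E ` ?I) \<union> \<Union> (E' ` ?I'))"
    using fin by (intro card_mono) (auto simp: E_def E'_def)
  also have "\<dots> \<le> card (\<Union> (E ` ?I)) + card (\<Union> (E' ` ?I'))" by (rule card_Un_le)
  also have "\<dots> \<le> (\<Sum>p\<in>?I. card (E p)) + (\<Sum>g\<in>?I'. card (E' g))"
    by (intro add_mono card_UN_le) auto
  finally have "real (card {x \<in> X. \<not> good_point (bs_mult m) K K ?a x})
      \<le> real ((\<Sum>p\<in>?I. card (E p)) + (\<Sum>g\<in>?I'. card (E' g)))" by (simp only: of_nat_le_iff)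
  also have "\<dots> = (\<Sum>p\<in>?I. real (card (E p))) + (\<Sum>g\<in>?I'. real (card (E' g)))" by simp
  also have "\<dots> \<le> (\<Sum>p\<in>?I. \<delta> * card X) + (\<Sum>g\<in>?I'. \<delta> * card X)"
  proof (intro add_mono sum_mono)
    have nonneg: "0 \<le> \<delta> * card X" using rel by linarith
    fix p assume "p \<in> ?I"
    then show "card (E p) \<le> \<delta> * card X"
      using coin[of "fst p" "snd p"] nonneg by (cases "fst p = snd p") (auto simp: E_def)
  next
    fix g assume "g \<in> ?I'"
    show "card (E' g) \<le> \<delta> * card X"
      unfolding E'_def using card_vimage_bij_betw[OF bij_betw_bs_act[OF bij], of R] rel
      by (simp add: R_def)
  qed
  also have "\<dots> = (L ^ 4 + L * M) * (\<delta> * card X)"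
    by (simp add: algebra_simps power4_eq_xxxx)
  finally show ?thesis .
qed

lemma inj_on_extend_bij_betw:
  assumes "finite X" "finite Y" "card X = card Y" "D \<subseteq> X" "\<sigma> ` D \<subseteq> Y" "inj_on \<sigma> D"
  shows "\<exists>\<tau>. bij_betw \<tau> X Y \<and> (\<forall>d\<in>D. \<tau> d = \<sigma> d)"
proof -
  have "card (\<sigma> ` D) = card D" using assms by (simp add: card_image)
  then have "card (X - D) = card (Y - \<sigma> ` D)"
    using assms by (metis card_Diff_subset finite_subset)
  then obtain \<rho> where \<rho>: "bij_betw \<rho> (X - D) (Y - \<sigma> ` D)"
    using assms finite_same_card_bij by (metis finite_Diff)
  let ?\<tau> = "\<lambda>x. if x \<in> D then \<sigma> x else \<rho> x"
  have "bij_betw ?\<tau> D (\<sigma> ` D)" using assms(6) by (auto simp: bij_betw_def inj_on_def)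
  moreover have "bij_betw ?\<tau> (X - D) (Y - \<sigma> ` D)"
    using \<rho> by (subst bij_betw_cong[of "X - D" ?\<tau> \<rho>]) auto
  ultimately have "bij_betw ?\<tau> (D \<union> (X - D)) (\<sigma> ` D \<union> (Y - \<sigma> ` D))"
    by (intro bij_betw_combine) auto
  moreover have "D \<union> (X - D) = X" "\<sigma> ` D \<union> (Y - \<sigma> ` D) = Y" using assms by auto
  ultimately show ?thesis by (intro exI[of _ ?\<tau>]) auto
qed

theorem almost_bs_conjugate:
  fixes \<epsilon> :: real
  assumes "0 < \<epsilon>"
  shows "\<exists>L \<delta>. 0 < \<delta> \<and> (\<forall>(X::'a set) A B (Y::'b set) A' B'.
    almost_bs m L \<delta> X A B \<longrightarrow> almost_bs m L \<delta> Y A' B' \<longrightarrow> card X = card Y \<longrightarrow>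
    (\<exists>\<sigma>. bij_betw \<sigma> X Y \<and>
      card {x \<in> X. \<sigma> (A x) \<noteq> A' (\<sigma> x) \<or> \<sigma> (B x) \<noteq> B' (\<sigma> x)} \<le> \<epsilon> * card X))"
proof -
  \<comment> \<open>The 15 is 3 + 6 + 6: points outside \<open>D\<close>, then intertwining failures
    for each of the two generators.\<close>
  define e where "e = min (\<epsilon> / 15) (1 / 4)"
  have e: "0 < e" "e \<le> 1 / 4" "15 * e \<le> \<epsilon>" using assms by (auto simp: e_def)
  \<comment> \<open>After \<open>k\<close> rounds the coverage of the two spaces would exceed 2 card
    X, so one of them must be nearly covered; since \<open>D\<close> is nearly as large as either
    union, one is enough.\<close>
  obtain k :: nat where k: "4 / e\<^sup>2 < k" using reals_Archimedean2 by blast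
  let ?S = "{(1, 0), (0, 1)} :: (nat \<times> nat) set"
  define Q where "Q K \<longleftrightarrow> (\<forall>(X::'a set) (Y::'b set) a b. finite X \<longrightarrow> finite Y \<longrightarrow> card X = card Y \<longrightarrow>
    (\<forall>g. bij_betw (a g) X X) \<longrightarrow> (\<forall>g. bij_betw (b g) Y Y) \<longrightarrow>
    card {x \<in> X. \<not> good_point (bs_mult m) K K a x} \<le> e / 4 * card X \<longrightarrow>
    card {y \<in> Y. \<not> good_point (bs_mult m) K K b y} \<le> e / 4 * card X \<longrightarrow>
    (\<exists>U V D \<sigma>. partial_conjugacy e ?S a b U V D \<sigma> \<and> U \<subseteq> X \<and> V \<subseteq> Y \<and>
    almost_invariant a {} ((1::real) * card D) U \<and> almost_invariant b {} ((1::real) * card D) V \<and>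
    (card U \<ge> (1 - e) * card X \<or> card V \<ge> (1 - e) * card X \<or>
     real (card U) + card V \<ge> k * (e\<^sup>2 / 2 * card X))))" for K
  have "\<exists>K. finite K \<and> Q K"
    unfolding Q_def
    by (rule exists_partial_conjugacy[where mul = "bs_mult m"]) (use e in \<open>simp_all add: bs_foelner inj_bs_mult\<close>)
  then obtain K where K: "finite K" and Q: "Q K" by (elim exE conjE)
  obtain L where L: "K \<subseteq> {..<L} \<times> {..<L}"
  proof
    show "K \<subseteq> {..<Suc (Max (fst ` K \<union> snd ` K))} \<times> {..<Suc (Max (fst ` K \<union> snd ` K))}"
      using K by (auto simp: less_Suc_eq_le intro!: Max_ge rev_image_eqI)
  qed
  define M where "M = L * (m + 1) ^ L + L"
  define c where "c = real (L ^ 4 + L * M) + 1"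
  have c: "0 < c" unfolding c_def by (rule add_nonneg_pos) auto
  define \<delta> where "\<delta> = e / 4 / c"
  have d: "0 < \<delta>" using e c by (simp add: \<delta>_def)
  have small: "card {x \<in> X. \<not> good_point (bs_mult m) K K (bs_act A B) x} \<le> e / 4 * card X"
    if "almost_bs m L \<delta> X A B" for X :: "'z set" and A B
  proof -
    have "card {x \<in> X. \<not> good_point (bs_mult m) K K (bs_act A B) x} \<le> (L ^ 4 + L * M) * (\<delta> * card X)"
      using almost_bs_card_bad[OF that L M_def] .
    also have "\<dots> \<le> c * (\<delta> * card X)" using d by (intro mult_right_mono) (auto simp: c_def)
    also have "\<dots> = e / 4 * card X" using c by (simp add: \<delta>_def)
    finally show ?thesis .
  qed
  show ?thesis
  proof (intro exI[of _ L] exI[of _ \<delta>] conjI d allI impI)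
    fix X :: "'a set" and Y :: "'b set" and A B A' B'
    assume bs: "almost_bs m L \<delta> X A B" "almost_bs m L \<delta> Y A' B'" and card: "card X = card Y"
    have fin: "finite X" "finite Y" using bs by (auto simp: almost_bs_def)
    have bij: "\<forall>g. bij_betw (bs_act A B g) X X" "\<forall>g. bij_betw (bs_act A' B' g) Y Y"
      using bs by (auto simp: almost_bs_def intro!: bij_betw_bs_act)
    have bad2: "card {y \<in> Y. \<not> good_point (bs_mult m) K K (bs_act A' B') y} \<le> e / 4 * card X"
      using small[OF bs(2)] card by simp
    obtain U V D \<sigma> where pc: "partial_conjugacy e ?S (bs_act A B) (bs_act A' B') U V D \<sigma>" "U \<subseteq> X" "V \<subseteq> Y"
      and alt: "card U \<ge> (1 - e) * card X \<or> card V \<ge> (1 - e) * card X \<or>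
        real (card U) + card V \<ge> k * (e\<^sup>2 / 2 * card X)"
      using Q[unfolded Q_def, rule_format, of X Y "bs_act A B" "bs_act A' B'",
          OF fin card bij[rule_format] small[OF bs(1)] bad2] by blast
    have "card U \<ge> (1 - e) * card X \<or> card V \<ge> (1 - e) * card X"
    proof (cases "card X = 0")
      case False
      have "card U \<le> card X" "card V \<le> card X" using pc fin card by (metis card_mono)+
      moreover have "2 < k * (e\<^sup>2 / 2)" using k e by (simp add: field_simps)
      then have "2 * real (card X) < k * (e\<^sup>2 / 2) * card X"
        using False by (intro mult_strict_right_mono) auto
      ultimately show ?thesis using alt by (auto simp: algebra_simps)
    qed simp
    then have "(1 - 2 * e) * ((1 - e) * card X) \<le> (1 - 2 * e) * card U \<or>
       (1 - 2 * e) * ((1 - e) * card X) \<le> (1 - 2 * e) * card V"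
      using e by (auto intro!: mult_left_mono)
    then have "(1 - 2 * e) * ((1 - e) * card X) \<le> card D"
      using pc(1) by (auto simp: partial_conjugacy_def)
    moreover have "(1 - 3 * e) * card X \<le> (1 - 2 * e) * ((1 - e) * card X)"
      using e by (simp add: algebra_simps)
    ultimately have D: "(1 - 3 * e) * card X \<le> card D" by linarith
    have DX: "D \<subseteq> X" "\<sigma> ` D \<subseteq> Y" "inj_on \<sigma> D"
      using pc by (auto simp: partial_conjugacy_def)
    obtain \<tau> where \<tau>: "bij_betw \<tau> X Y" "\<forall>d\<in>D. \<tau> d = \<sigma> d"
      using inj_on_extend_bij_betw[OF fin card DX] by blast
    let ?bad = "\<lambda>s. {d \<in> D. bs_act A B s d \<notin> D \<or> \<sigma> (bs_act A B s d) \<noteq> bs_act A' B' s (\<sigma> d)}"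
    have bad: "card (?bad s) \<le> 6 * e * card D" if "s \<in> ?S" for s
      using pc(1) that unfolding partial_conjugacy_def by blast
    have finD: "finite D" using DX fin finite_subset by blast
    have "{x \<in> X. \<tau> (A x) \<noteq> A' (\<tau> x) \<or> \<tau> (B x) \<noteq> B' (\<tau> x)} \<subseteq> (X - D) \<union> (?bad (1, 0) \<union> ?bad (0, 1))"
      using \<tau>(2) by (auto simp: bs_act_def)
    then have "card {x \<in> X. \<tau> (A x) \<noteq> A' (\<tau> x) \<or> \<tau> (B x) \<noteq> B' (\<tau> x)}
        \<le> card ((X - D) \<union> (?bad (1, 0) \<union> ?bad (0, 1)))"
      using fin finD by (intro card_mono) auto
    also have "\<dots> \<le> card (X - D) + card (?bad (1, 0) \<union> ?bad (0, 1))" by (rule card_Un_le)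
    also have "\<dots> \<le> card (X - D) + (card (?bad (1, 0)) + card (?bad (0, 1)))"
      by (intro add_left_mono card_Un_le)
    finally have 1: "card {x \<in> X. \<tau> (A x) \<noteq> A' (\<tau> x) \<or> \<tau> (B x) \<noteq> B' (\<tau> x)}
      \<le> card (X - D) + (card (?bad (1, 0)) + card (?bad (0, 1)))" .
    have leD: "card D \<le> card X" using DX fin by (simp add: card_mono)
    have "real (card (X - D)) = card X - real (card D)"
      using DX fin finD leD by (simp add: card_Diff_subset)
    moreover have "6 * e * card D \<le> 6 * e * card X" using leD e by (intro mult_left_mono) auto
    ultimately have "card {x \<in> X. \<tau> (A x) \<noteq> A' (\<tau> x) \<or> \<tau> (B x) \<noteq> B' (\<tau> x)} \<le> 15 * e * card X"
      using 1 bad[of "(1, 0)"] bad[of "(0, 1)"] D by (simp add: algebra_simps)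
    also have "\<dots> \<le> \<epsilon> * card X" using e by (intro mult_right_mono) auto
    finally show "\<exists>\<sigma>. bij_betw \<sigma> X Y \<and>
      card {x \<in> X. \<sigma> (A x) \<noteq> A' (\<sigma> x) \<or> \<sigma> (B x) \<noteq> B' (\<sigma> x)} \<le> \<epsilon> * card X"
      using \<tau>(1) by blast
  qed
qed

section \<open>The generators have infinite order\<close>

text \<open>Normal forms for the amalgam of \<open>\<langle>a\<^sub>1, a\<^sub>2\<rangle>\<close> and \<open>\<langle>a\<^sub>2, a\<^sub>3\<rangle>\<close> over \<open>\<langle>a\<^sub>2\<rangle>\<close>: a pair \<open>(c, s)\<close> is \<open>a\<^sub>2\<^sup>c\<close> followed by an
  alternating word \<open>s\<close> of nontrivial coset representatives.  In the first group \<open>a\<^sub>1\<close>, \<open>a\<^sub>2\<close> are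
  \<open>x \<mapsto> x / m\<close>, \<open>x \<mapsto> x + 1\<close>, and \<open>S1 r k\<close> is the map \<open>x \<mapsto> x / m\<^sup>k + r\<close>; in the second group \<open>a\<^sub>2\<close>, \<open>a\<^sub>3\<close> are
  \<open>x \<mapsto> x / m\<close>, \<open>x \<mapsto> x + 1\<close>, and \<open>S2 v\<close> is the translation by \<open>v\<close>.  Real translation lengths are allowed, which only enlarges the groups.\<close>

datatype syllable = S1 real int | S2 real

fun starts1 :: "syllable list \<Rightarrow> bool" where
  "starts1 (S1 r k # s) = True"
| "starts1 s = False"

fun starts2 :: "syllable list \<Rightarrow> bool" where
  "starts2 (S2 v # s) = True"
| "starts2 s = False"

fun normal :: "syllable list \<Rightarrow> bool" where
  "normal [] = True"
| "normal (S1 r k # s) \<longleftrightarrow> 0 \<le> r \<and> r < 1 \<and> (r \<noteq> 0 \<or> k \<noteq> 0) \<and> \<not> starts1 s \<and> normal s"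
| "normal (S2 v # s) \<longleftrightarrow> v \<noteq> 0 \<and> \<not> starts2 s \<and> normal s"

definition normal_forms :: "(int \<times> syllable list) set"
  where "normal_forms = {(c, s). normal s}"

text \<open>The first-group element x -> x / m^k + \<rho>, followed by \<open>s\<close>. Integer and
  fractional part of \<rho> give the power of \<open>a2\<close> and the coset representative; a
  trivial representative leaves no syllable.\<close>

definition join1 :: "real \<Rightarrow> int \<Rightarrow> syllable list \<Rightarrow> int \<times> syllable list"
  where "join1 \<rho> k s = (\<lfloor>\<rho>\<rfloor>, if frac \<rho> = 0 \<and> k = 0 then s else S1 (frac \<rho>) k # s)"

fun split1 :: "int \<times> syllable list \<Rightarrow> real \<times> int \<times> syllable list" where
  "split1 (c, S1 r k # s) = (c + r, k, s)"
| "split1 (c, s) = (c, 0, s)"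

text \<open>The second-group element x -> (x + v) / m^c, followed by \<open>s\<close>.\<close>

definition join2 :: "int \<Rightarrow> real \<Rightarrow> syllable list \<Rightarrow> int \<times> syllable list"
  where "join2 c v s = (c, if v = 0 then s else S2 v # s)"

fun split2 :: "int \<times> syllable list \<Rightarrow> int \<times> real \<times> syllable list" where
  "split2 (c, S2 v # s) = (c, v, s)"
| "split2 (c, s) = (c, 0, s)"

text \<open>\<open>P1 m e\<close>, \<open>P2 e\<close>, \<open>P3 m e\<close> are left multiplication by the \<open>e\<close>-th powers of \<open>a\<^sub>1\<close>, \<open>a\<^sub>2\<close>, \<open>a\<^sub>3\<close>.\<close>

definition P1 :: "nat \<Rightarrow> int \<Rightarrow> int \<times> syllable list \<Rightarrow> int \<times> syllable list"
  where "P1 m e \<omega> = (case split1 \<omega> of (\<rho>, k, s) \<Rightarrow> join1 (\<rho> * real m powi (- e)) (k + e) s)"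

definition P2 :: "int \<Rightarrow> int \<times> syllable list \<Rightarrow> int \<times> syllable list"
  where "P2 e \<omega> = (fst \<omega> + e, snd \<omega>)"

definition P3 :: "nat \<Rightarrow> int \<Rightarrow> int \<times> syllable list \<Rightarrow> int \<times> syllable list"
  where "P3 m e \<omega> = (case split2 \<omega> of (c, v, s) \<Rightarrow> join2 c (v + real_of_int e * real m powi c) s)"

lemma split1_join1: "\<not> starts1 s \<Longrightarrow> split1 (join1 \<rho> k s) = (\<rho>, k, s)"
  by (cases s rule: starts1.cases) (auto simp: join1_def frac_def)

lemma split2_join2: "\<not> starts2 s \<Longrightarrow> split2 (join2 c v s) = (c, v, s)"
  by (cases s rule: starts2.cases) (auto simp: join2_def)

lemma P1_join1: "\<not> starts1 s \<Longrightarrow> P1 m e (join1 \<rho> k s) = join1 (\<rho> * real m powi (- e)) (k + e) s"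
  by (simp add: P1_def split1_join1)

lemma P3_join2: "\<not> starts2 s \<Longrightarrow> P3 m e (join2 c v s) = join2 c (v + e * real m powi c) s"
  by (simp add: P3_def split2_join2)

text \<open>This and the next lemma say that adding to the leading integer is multiplication by a
  power of \<open>a2\<close> in either group. That agreement makes both relations hold in one
  action.\<close>

lemma P2_join1: "P2 e (join1 \<rho> k s) = join1 (\<rho> + e) k s"
  by (auto simp: P2_def join1_def frac_def)

lemma P2_join2: "P2 e (join2 c v s) = join2 (c + e) v s"
  by (simp add: P2_def join2_def)

lemma normal_forms_join1: "\<not> starts1 s \<Longrightarrow> normal s \<Longrightarrow> join1 \<rho> k s \<in> normal_forms"
  by (auto simp: normal_forms_def join1_def frac_lt_1)

lemma normal_forms_join2: "\<not> starts2 s \<Longrightarrow> normal s \<Longrightarrow> join2 c v s \<in> normal_forms"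
  by (auto simp: normal_forms_def join2_def)

lemma normal_forms_cases1:
  assumes "\<omega> \<in> normal_forms"
  obtains \<rho> k s where "\<omega> = join1 \<rho> k s" "\<not> starts1 s" "normal s"
proof -
  obtain c t where \<omega>: "\<omega> = (c, t)" "normal t" using assms by (auto simp: normal_forms_def)
  show thesis
  proof (cases "starts1 t")
    case True
    then obtain r k s where t: "t = S1 r k # s" by (cases t rule: starts1.cases) auto
    then have r: "0 \<le> r" "r < 1" using \<omega> by auto
    then have "\<lfloor>real_of_int c + r\<rfloor> = c" by linarith
    then have "\<omega> = join1 (c + r) k s" using \<omega> t by (auto simp: join1_def frac_def)
    then show thesis using that \<omega> t by auto
  next
    case False
    then have "\<omega> = join1 c 0 t" using \<omega> by (simp add: join1_def)
    then show thesis using that \<omega> False by auto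
  qed
qed

lemma normal_forms_cases2:
  assumes "\<omega> \<in> normal_forms"
  obtains c v s where "\<omega> = join2 c v s" "\<not> starts2 s" "normal s"
proof -
  obtain c t where \<omega>: "\<omega> = (c, t)" "normal t" using assms by (auto simp: normal_forms_def)
  show thesis
  proof (cases "starts2 t")
    case True
    then obtain v s where t: "t = S2 v # s" by (cases t rule: starts2.cases) auto
    then have "\<omega> = join2 c v s" using \<omega> by (auto simp: join2_def)
    then show thesis using that \<omega> t by auto
  next
    case False
    then have "\<omega> = join2 c 0 t" using \<omega> by (simp add: join2_def)
    then show thesis using that \<omega> False by auto
  qed
qed

lemma P_closed:
  assumes "\<omega> \<in> normal_forms"
  shows "P1 m e \<omega> \<in> normal_forms" "P2 e \<omega> \<in> normal_forms" "P3 m e \<omega> \<in> normal_forms"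
proof -
  show "P1 m e \<omega> \<in> normal_forms"
    using assms by (elim normal_forms_cases1) (simp add: P1_join1 normal_forms_join1)
  show "P2 e \<omega> \<in> normal_forms" using assms by (auto simp: P2_def normal_forms_def)
  show "P3 m e \<omega> \<in> normal_forms"
    using assms by (elim normal_forms_cases2) (simp add: P3_join2 normal_forms_join2)
qed

lemma P_0:
  assumes "\<omega> \<in> normal_forms"
  shows "P1 m 0 \<omega> = \<omega>" "P2 0 \<omega> = \<omega>" "P3 m 0 \<omega> = \<omega>"
proof -
  show "P1 m 0 \<omega> = \<omega>" using assms by (elim normal_forms_cases1) (simp add: P1_join1)
  show "P2 0 \<omega> = \<omega>" by (simp add: P2_def)
  show "P3 m 0 \<omega> = \<omega>" using assms by (elim normal_forms_cases2) (simp add: P3_join2)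
qed

lemma P_add:
  assumes "\<omega> \<in> normal_forms" "0 < m"
  shows "P1 m e (P1 m e' \<omega>) = P1 m (e + e') \<omega>" "P2 e (P2 e' \<omega>) = P2 (e + e') \<omega>"
    "P3 m e (P3 m e' \<omega>) = P3 m (e + e') \<omega>"
proof -
  have pw: "real m powi (- e - e') = real m powi (- e) * real m powi (- e')"
    using power_int_add[of "real m" "- e" "- e'"] assms by simp
  show "P1 m e (P1 m e' \<omega>) = P1 m (e + e') \<omega>"
    using assms by (elim normal_forms_cases1) (simp add: P1_join1 pw algebra_simps)
  show "P2 e (P2 e' \<omega>) = P2 (e + e') \<omega>" by (simp add: P2_def)
  show "P3 m e (P3 m e' \<omega>) = P3 m (e + e') \<omega>"
    using assms by (elim normal_forms_cases2) (simp add: P3_join2 algebra_simps)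
qed

lemma P_relations:
  assumes "\<omega> \<in> normal_forms" "0 < m"
  shows "P2 1 (P1 m 1 \<omega>) = P1 m 1 (P2 (int m) \<omega>)" "P3 m 1 (P2 1 \<omega>) = P2 1 (P3 m (int m) \<omega>)"
proof -
  show "P2 1 (P1 m 1 \<omega>) = P1 m 1 (P2 (int m) \<omega>)"
    using assms by (elim normal_forms_cases1) (simp add: P1_join1 P2_join1 field_simps)
  show "P3 m 1 (P2 1 \<omega>) = P2 1 (P3 m (int m) \<omega>)"
    using assms by (elim normal_forms_cases2) (simp add: P2_join2 P3_join2 power_int_add mult.commute)
qed

section \<open>The free group on the first and third generators\<close>

text \<open>\<open>(False, e)\<close> stands for the \<open>e\<close>-th power of the first generator, \<open>(True, e)\<close> for that of the third.\<close>

definition gen13 :: "nat \<Rightarrow> bool \<times> int \<Rightarrow> int \<times> syllable list \<Rightarrow> int \<times> syllable list"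
  where "gen13 m x = (if fst x then P3 m (snd x) else P1 m (snd x))"

definition eval13 :: "nat \<Rightarrow> (bool \<times> int) list \<Rightarrow> int \<times> syllable list \<Rightarrow> int \<times> syllable list"
  where "eval13 m w = foldr (gen13 m) w"

definition swap13 :: "(bool \<times> int) list \<Rightarrow> (bool \<times> int) list"
  where "swap13 = map (apfst Not)"

definition inv13 :: "(bool \<times> int) list \<Rightarrow> (bool \<times> int) list"
  where "inv13 w = rev (map (apsnd uminus) w)"

fun reduced13 :: "(bool \<times> int) list \<Rightarrow> bool" where
  "reduced13 [] = True"
| "reduced13 [(b, e)] \<longleftrightarrow> e \<noteq> 0"
| "reduced13 ((b, e) # (b', e') # w) \<longleftrightarrow> e \<noteq> 0 \<and> b \<noteq> b' \<and> reduced13 ((b', e') # w)"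

lemma swap13_simps [simp]:
  "swap13 [] = []" "swap13 (u @ v) = swap13 u @ swap13 v" "swap13 ((b, e) # v) = (\<not> b, e) # swap13 v"
  by (simp_all add: swap13_def)

lemma swap13_swap13 [simp]: "swap13 (swap13 w) = w"
  by (induction w) (auto simp: swap13_def)

lemma swap13_inv13: "swap13 (inv13 w) = inv13 (swap13 w)"
  by (simp add: swap13_def inv13_def rev_map comp_def)

lemma eval13_simps:
  "eval13 m [] \<omega> = \<omega>" "eval13 m (u @ v) \<omega> = eval13 m u (eval13 m v \<omega>)"
  "eval13 m (x # v) \<omega> = gen13 m x (eval13 m v \<omega>)"
  by (simp_all add: eval13_def)

lemma gen13_closed: "\<omega> \<in> normal_forms \<Longrightarrow> gen13 m x \<omega> \<in> normal_forms"
  by (simp add: gen13_def P_closed)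

lemma eval13_closed: "\<omega> \<in> normal_forms \<Longrightarrow> eval13 m w \<omega> \<in> normal_forms"
  by (induction w) (auto simp: eval13_simps gen13_closed)

lemma gen13_0: "\<omega> \<in> normal_forms \<Longrightarrow> gen13 m (b, 0) \<omega> = \<omega>"
  by (simp add: gen13_def P_0)

lemma gen13_add:
  "\<omega> \<in> normal_forms \<Longrightarrow> 0 < m \<Longrightarrow> gen13 m (b, e) (gen13 m (b, e') \<omega>) = gen13 m (b, e + e') \<omega>"
  by (simp add: gen13_def P_add)

lemma gen13_inv: "\<omega> \<in> normal_forms \<Longrightarrow> 0 < m \<Longrightarrow> gen13 m (apsnd uminus x) (gen13 m x \<omega>) = \<omega>"
  by (cases x) (simp add: gen13_add gen13_0)

lemma eval13_inv: "\<omega> \<in> normal_forms \<Longrightarrow> 0 < m \<Longrightarrow> eval13 m (inv13 w) (eval13 m w \<omega>) = \<omega>"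
  by (induction w) (auto simp: inv13_def eval13_simps gen13_inv eval13_closed)

lemma inv13_inv13 [simp]: "inv13 (inv13 w) = w"
  by (induction w) (auto simp: inv13_def)

text \<open>Either defect allows the word to be shortened without changing its action, by deleting a
  letter or merging two, and the shortening commutes with \<open>swap13\<close>.\<close>

lemma not_reduced13:
  "\<not> reduced13 w \<Longrightarrow> (\<exists>u v b. w = u @ (b, 0) # v) \<or> (\<exists>u v b e e'. w = u @ (b, e) # (b, e') # v)"
proof (induction w rule: reduced13.induct)
  case (2 b e)
  then show ?case by force
next
  case (3 b e b' e' w)
  show ?case
  proof (cases "e = 0 \<or> b = b'")
    case True
    then have "(b, e) # (b', e') # w = [] @ (b, 0) # (b', e') # w \<or>
        (b, e) # (b', e') # w = [] @ (b, e) # (b, e') # w" by auto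
    then show ?thesis by blast
  next
    case False
    with 3 show ?thesis by (metis append_Cons reduced13.simps(3))
  qed
qed simp

text \<open>The outermost power always meets a form that does not start in its own factor. The
  syllable it creates has \<open>k = e\<close> or v = e m^c, so it is nontrivial and stays at the
  front.\<close>

lemma reduced13_starts:
  assumes "reduced13 w" "w \<noteq> []" "0 < m"
  shows "if fst (hd w) then starts2 (snd (eval13 m w (0, []))) else starts1 (snd (eval13 m w (0, [])))"
  using assms
proof (induction w rule: reduced13.induct)
  have key: "if b then starts2 (snd (gen13 m (b, e) \<omega>)) else starts1 (snd (gen13 m (b, e) \<omega>))"
    if "e \<noteq> 0" "\<not> (if b then starts2 (snd \<omega>) else starts1 (snd \<omega>))" for b e \<omega>
  proof -
    obtain c s where \<omega>: "\<omega> = (c, s)" by (cases \<omega>)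
    have j: "\<omega> = join2 c 0 s" "\<omega> = join1 c 0 s" using \<omega> by (simp_all add: join1_def join2_def)
    show ?thesis
    proof (cases b)
      case True
      then have "\<not> starts2 s" using that \<omega> by simp
      then have "gen13 m (b, e) \<omega> = join2 c (0 + e * real m powi c) s"
        using True j(1) P3_join2[of s m e c 0] by (simp add: gen13_def)
      then show ?thesis using True that \<open>0 < m\<close> by (simp add: join2_def)
    next
      case False
      then have "\<not> starts1 s" using that \<omega> by simp
      then have "gen13 m (b, e) \<omega> = join1 (c * real m powi (- e)) (0 + e) s"
        using False j(2) P1_join1[of s m e c 0] by (simp add: gen13_def)
      then show ?thesis using False that by (simp add: join1_def)
    qed
  qed
  {
    case (2 b e)
    then show ?case using key[of e b "(0, [])"] by (cases b) (simp_all add: eval13_simps)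
  next
    case (3 b e b' e' w)
    have "starts1 s \<Longrightarrow> \<not> starts2 s" for s by (cases s rule: starts1.cases) auto
    then have "\<not> (if b then starts2 (snd (eval13 m ((b', e') # w) (0, []))) else starts1 (snd (eval13 m ((b', e') # w) (0, []))))"
      using 3 by (auto split: if_splits)
    then show ?case using 3 key[of e b "eval13 m ((b', e') # w) (0, [])"]
      by (cases b; cases b') (simp_all add: eval13_simps(3))
  }
qed simp

text \<open>The first and the third generator generate a free group, by ping-pong at the empty normal form.\<close>

lemma eval13_swap13_trivial:
  assumes "0 < m" "\<And>\<omega>. \<omega> \<in> normal_forms \<Longrightarrow> eval13 m w \<omega> = \<omega>" "\<omega> \<in> normal_forms"
  shows "eval13 m (swap13 w) \<omega> = \<omega>"
  using assms(2,3)
proof (induction w arbitrary: \<omega> rule: length_induct)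
  case (1 w)
  have IH: "eval13 m (swap13 w') \<omega> = \<omega>"
    if "length w' < length w" "\<And>\<omega>'. \<omega>' \<in> normal_forms \<Longrightarrow> eval13 m w' \<omega>' = \<omega>'" for w'
    using "1.IH" that "1.prems"(2) by blast
  consider "reduced13 w" | u v b where "w = u @ (b, 0) # v" | u v b e e' where "w = u @ (b, e) # (b, e') # v"
    using not_reduced13 by blast
  then show ?case
  proof cases
    case 1
    have "(0, []) \<in> normal_forms" by (simp add: normal_forms_def)
    then have "eval13 m w (0, []) = (0, [])" using "1.prems" by blast
    then have "w = []" using reduced13_starts[OF 1 _ assms(1)]
      by (cases "w = []"; cases "fst (hd w)") simp_all
    then show ?thesis by (simp add: eval13_simps)
  next
    case 2
    have "eval13 m (u @ v) \<omega>' = \<omega>'" if "\<omega>' \<in> normal_forms" for \<omega>'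
      using "1.prems"(1)[OF that] that 2 by (simp add: eval13_simps gen13_0 eval13_closed)
    then have "eval13 m (swap13 (u @ v)) \<omega> = \<omega>" using 2 by (intro IH) auto
    then show ?thesis using 2 "1.prems"(2) by (simp add: eval13_simps gen13_0 eval13_closed)
  next
    case 3
    have "eval13 m (u @ (b, e + e') # v) \<omega>' = \<omega>'" if "\<omega>' \<in> normal_forms" for \<omega>'
      using "1.prems"(1)[OF that] that 3 by (simp add: eval13_simps gen13_add[OF _ assms(1)] eval13_closed)
    then have "eval13 m (swap13 (u @ (b, e + e') # v)) \<omega> = \<omega>" using 3 by (intro IH) auto
    then show ?thesis using 3 "1.prems"(2)
      by (simp add: eval13_simps gen13_add[OF _ assms(1)] eval13_closed)
  qed
qed

section \<open>A free action and the involution exchanging two generators\<close>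

type_synonym nf_map = "int \<times> syllable list \<Rightarrow> int \<times> syllable list"

text \<open>Only the values of \<open>P1\<close>, \<open>P2\<close>, \<open>P3\<close> on normal forms matter, so maps onto the set of normal forms serve
  as a space on which any group of permutations of normal forms acts freely by composition.\<close>

definition nf_maps :: "nf_map set"
  where "nf_maps = {g. range g = normal_forms}"

lemma nf_maps_nonempty: "nf_maps \<noteq> {}"
proof -
  have "(0, []) \<in> normal_forms" by (simp add: normal_forms_def)
  then have "(\<lambda>\<omega>. if \<omega> \<in> normal_forms then \<omega> else (0, [])) \<in> nf_maps"
    by (auto simp: nf_maps_def image_def)
  then show ?thesis by blast
qed

lemma nf_maps_range: "g \<in> nf_maps \<Longrightarrow> g \<omega> \<in> normal_forms"
  by (auto simp: nf_maps_def)

lemma comp_nf_maps: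
  assumes "g \<in> nf_maps" "\<And>\<omega>. \<omega> \<in> normal_forms \<Longrightarrow> p \<omega> \<in> normal_forms"
    "\<And>\<omega>. \<omega> \<in> normal_forms \<Longrightarrow> q \<omega> \<in> normal_forms"
    "\<And>\<omega>. \<omega> \<in> normal_forms \<Longrightarrow> p (q \<omega>) = \<omega>"
  shows "p \<circ> g \<in> nf_maps"
proof -
  have "p ` normal_forms = normal_forms" using assms(2-4) by (auto simp: image_iff) metis
  moreover have "range (p \<circ> g) = p ` range g" by (rule image_comp [symmetric])
  ultimately show ?thesis using assms(1) by (simp only: nf_maps_def mem_Collect_eq)
qed

lemma comp_nf_maps_eq_iff:
  assumes "g \<in> nf_maps"
  shows "p \<circ> g = q \<circ> g \<longleftrightarrow> (\<forall>\<omega>\<in>normal_forms. p \<omega> = q \<omega>)"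
proof -
  have range: "normal_forms = range g" using assms by (simp add: nf_maps_def)
  show ?thesis unfolding range by (simp only: fun_eq_iff ball_simps comp_apply)
qed

lemma comp_gen_nf_maps:
  assumes "g \<in> nf_maps" "0 < m"
  shows "P1 m e \<circ> g \<in> nf_maps" "P2 e \<circ> g \<in> nf_maps" "P3 m e \<circ> g \<in> nf_maps"
proof -
  show "P1 m e \<circ> g \<in> nf_maps"
    by (rule comp_nf_maps[OF assms(1), of _ "P1 m (- e)"]) (simp_all add: P_closed P_add P_0 assms)
  show "P2 e \<circ> g \<in> nf_maps"
    by (rule comp_nf_maps[OF assms(1), of _ "P2 (- e)"]) (simp_all add: P_closed P_add[of _ 1] P_0)
  show "P3 m e \<circ> g \<in> nf_maps"
    by (rule comp_nf_maps[OF assms(1), of _ "P3 m (- e)"]) (simp_all add: P_closed P_add P_0 assms)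
qed

lemma eval13_nf_maps:
  assumes "g \<in> nf_maps" "0 < m"
  shows "eval13 m w \<circ> g \<in> nf_maps"
proof (rule comp_nf_maps[OF assms(1), of _ "eval13 m (inv13 w)"])
  fix \<omega> assume "\<omega> \<in> normal_forms"
  then show "eval13 m w (eval13 m (inv13 w) \<omega>) = \<omega>"
    using eval13_inv[of \<omega> m "inv13 w"] assms by simp
qed (simp_all add: eval13_closed)

lemma eval13_append_comp: "eval13 m (u @ v) \<circ> g = eval13 m u \<circ> (eval13 m v \<circ> g)"
  by (simp add: fun_eq_iff eval13_simps)

lemma eval13_inv_comp:
  assumes "g \<in> nf_maps" "0 < m"
  shows "eval13 m (inv13 w) \<circ> (eval13 m w \<circ> g) = g"
  using assms by (simp add: fun_eq_iff eval13_inv nf_maps_range)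

text \<open>Freeness turns equality at one \<open>g\<close> into triviality of the word
  \<open>inv13 v @ u\<close>, which survives the exchange. Hence the exchanged map does not depend
  on the word chosen to reach a point of an orbit.\<close>

lemma eval13_swap13_cong:
  assumes "g \<in> nf_maps" "0 < m" "eval13 m u \<circ> g = eval13 m v \<circ> g"
  shows "eval13 m (swap13 u) \<circ> g = eval13 m (swap13 v) \<circ> g"
proof -
  have eq: "eval13 m u \<omega> = eval13 m v \<omega>" if "\<omega> \<in> normal_forms" for \<omega>
    using assms comp_nf_maps_eq_iff that by blast
  have "eval13 m (inv13 v @ u) \<omega> = \<omega>" if "\<omega> \<in> normal_forms" for \<omega>
    using that assms(2) by (simp add: eval13_simps eq eval13_inv)
  then have triv: "eval13 m (swap13 (inv13 v @ u)) \<omega> = \<omega>" if "\<omega> \<in> normal_forms" for \<omega>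
    using eval13_swap13_trivial[OF assms(2)] that by blast
  have "eval13 m (swap13 u) \<omega> = eval13 m (swap13 v) \<omega>" if \<omega>: "\<omega> \<in> normal_forms" for \<omega>
  proof -
    let ?x = "eval13 m (swap13 u) \<omega>"
    have "eval13 m (swap13 v) (eval13 m (inv13 (swap13 v)) ?x) = ?x"
      using eval13_inv[of ?x m "inv13 (swap13 v)"] \<omega> assms(2) by (simp add: eval13_closed)
    moreover have "eval13 m (inv13 (swap13 v)) ?x = \<omega>"
      using triv[OF \<omega>] by (simp add: eval13_simps swap13_inv13)
    ultimately show ?thesis by simp
  qed
  then show ?thesis using comp_nf_maps_eq_iff[OF assms(1)] by blast
qed

text \<open>The subgroup generated by the first and third generators acts freely on \<open>nf_maps\<close>.  Hence exchanging
  these two generators extends, orbit by orbit, to an involution of \<open>nf_maps\<close>.\<close>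

definition orbit_rep :: "nat \<Rightarrow> nf_map \<Rightarrow> nf_map"
  where "orbit_rep m g = (SOME r. r \<in> nf_maps \<and> (\<exists>w. g = eval13 m w \<circ> r))"

definition orbit_word :: "nat \<Rightarrow> nf_map \<Rightarrow> (bool \<times> int) list"
  where "orbit_word m g = (SOME w. g = eval13 m w \<circ> orbit_rep m g)"

definition swap_map :: "nat \<Rightarrow> nf_map \<Rightarrow> nf_map"
  where "swap_map m g = eval13 m (swap13 (orbit_word m g)) \<circ> orbit_rep m g"

lemma orbit_rep:
  assumes "g \<in> nf_maps"
  shows "orbit_rep m g \<in> nf_maps" "g = eval13 m (orbit_word m g) \<circ> orbit_rep m g"
proof -
  have "g = eval13 m [] \<circ> g" by (simp add: fun_eq_iff eval13_simps)
  with assms have "\<exists>r. r \<in> nf_maps \<and> (\<exists>w. g = eval13 m w \<circ> r)" by blast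
  from someI_ex[OF this] have *: "orbit_rep m g \<in> nf_maps" "\<exists>w. g = eval13 m w \<circ> orbit_rep m g"
    unfolding orbit_rep_def by blast+
  then show "orbit_rep m g \<in> nf_maps" by blast
  show "g = eval13 m (orbit_word m g) \<circ> orbit_rep m g"
    using someI_ex[OF *(2)] unfolding orbit_word_def .
qed

text \<open>The predicate under the choice operator is the same for all points of an orbit, so the
  chosen representatives are equal.\<close>

lemma orbit_rep_eval13:
  assumes "g \<in> nf_maps" "0 < m"
  shows "orbit_rep m (eval13 m u \<circ> g) = orbit_rep m g"
proof -
  have "(\<exists>w. eval13 m u \<circ> g = eval13 m w \<circ> r) \<longleftrightarrow> (\<exists>w. g = eval13 m w \<circ> r)" for r
  proof
    assume "\<exists>w. eval13 m u \<circ> g = eval13 m w \<circ> r"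
    then obtain w where "eval13 m u \<circ> g = eval13 m w \<circ> r" by blast
    then have "g = eval13 m (inv13 u @ w) \<circ> r"
      using eval13_inv_comp[OF assms, of u] by (simp add: eval13_append_comp)
    then show "\<exists>w. g = eval13 m w \<circ> r" by blast
  next
    assume "\<exists>w. g = eval13 m w \<circ> r"
    then show "\<exists>w. eval13 m u \<circ> g = eval13 m w \<circ> r" by (metis eval13_append_comp)
  qed
  then show ?thesis by (simp add: orbit_rep_def)
qed

lemma swap_map_eqI:
  assumes "g \<in> nf_maps" "0 < m" "g = eval13 m w \<circ> orbit_rep m g"
  shows "swap_map m g = eval13 m (swap13 w) \<circ> orbit_rep m g"
  unfolding swap_map_def
  using orbit_rep[OF assms(1)] assms by (intro eval13_swap13_cong) metis+

lemma swap_map_eval13: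
  assumes "g \<in> nf_maps" "0 < m"
  shows "swap_map m (eval13 m u \<circ> g) = eval13 m (swap13 u) \<circ> swap_map m g"
proof -
  let ?r = "orbit_rep m g" and ?w = "orbit_word m g"
  note rep = orbit_rep_eval13[OF assms, of u]
  have "eval13 m u \<circ> g = eval13 m (u @ ?w) \<circ> orbit_rep m (eval13 m u \<circ> g)"
    using orbit_rep(2)[OF assms(1)] rep by (metis eval13_append_comp)
  from swap_map_eqI[OF eval13_nf_maps[OF assms] assms(2) this]
  have "swap_map m (eval13 m u \<circ> g) = eval13 m (swap13 (u @ ?w)) \<circ> ?r"
    unfolding rep .
  then show ?thesis by (simp add: swap_map_def eval13_append_comp)
qed

lemma swap_map_nf_maps: "g \<in> nf_maps \<Longrightarrow> 0 < m \<Longrightarrow> swap_map m g \<in> nf_maps"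
  by (simp add: swap_map_def eval13_nf_maps orbit_rep)

lemma swap_map_swap_map:
  assumes "g \<in> nf_maps" "0 < m"
  shows "swap_map m (swap_map m g) = g"
proof -
  let ?r = "orbit_rep m g" and ?w = "orbit_word m g"
  have r: "?r \<in> nf_maps" using orbit_rep assms by blast
  have "orbit_rep m (swap_map m g) = orbit_rep m ?r"
    unfolding swap_map_def using orbit_rep_eval13 r assms by blast
  also have "\<dots> = ?r"
    using orbit_rep_eval13[OF r assms(2), of ?w] orbit_rep(2)[OF assms(1)] by metis
  finally have rep: "orbit_rep m (swap_map m g) = ?r" .
  have "swap_map m (swap_map m g) = eval13 m (swap13 (swap13 ?w)) \<circ> ?r"
    using swap_map_eqI[OF swap_map_nf_maps[OF assms] assms(2), of "swap13 ?w"] rep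
    by (simp add: swap_map_def)
  then show ?thesis using orbit_rep(2)[OF assms(1)] by simp
qed

lemma swap_map_gen:
  assumes "g \<in> nf_maps" "0 < m"
  shows "swap_map m (P1 m e \<circ> g) = P3 m e \<circ> swap_map m g"
    "swap_map m (P3 m e \<circ> g) = P1 m e \<circ> swap_map m g"
proof -
  have "eval13 m [(False, e)] = P1 m e" "eval13 m [(True, e)] = P3 m e"
    by (auto simp: eval13_def gen13_def)
  then show "swap_map m (P1 m e \<circ> g) = P3 m e \<circ> swap_map m g"
    "swap_map m (P3 m e \<circ> g) = P1 m e \<circ> swap_map m g"
    using swap_map_eval13[OF assms, of "[(False, e)]"] swap_map_eval13[OF assms, of "[(True, e)]"] by simp_all
qed

section \<open>The action of all four generators\<close>

fun H4_gen :: "nat \<Rightarrow> gen4 \<Rightarrow> int \<Rightarrow> nf_map \<Rightarrow> nf_map" where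
  "H4_gen m a1 e g = P1 m e \<circ> g"
| "H4_gen m a2 e g = P2 e \<circ> g"
| "H4_gen m a3 e g = P3 m e \<circ> g"
| "H4_gen m a4 e g = swap_map m (P2 e \<circ> swap_map m g)"

fun letter_act :: "nat \<Rightarrow> gen4 letter \<Rightarrow> nf_map \<Rightarrow> nf_map" where
  "letter_act m (Pos x) = H4_gen m x 1"
| "letter_act m (Neg x) = H4_gen m x (- 1)"

definition word_act :: "nat \<Rightarrow> gen4 letter list \<Rightarrow> nf_map \<Rightarrow> nf_map"
  where "word_act m w = foldr (letter_act m) w"

lemma H4_gen_closed: "g \<in> nf_maps \<Longrightarrow> 0 < m \<Longrightarrow> H4_gen m x e g \<in> nf_maps"
  by (cases x) (simp_all add: comp_gen_nf_maps swap_map_nf_maps)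

lemma H4_gen_add:
  assumes "g \<in> nf_maps" "0 < m"
  shows "H4_gen m x e (H4_gen m x e' g) = H4_gen m x (e + e') g"
proof -
  have "P1 m e \<circ> (P1 m e' \<circ> g) = P1 m (e + e') \<circ> g" "P3 m e \<circ> (P3 m e' \<circ> g) = P3 m (e + e') \<circ> g"
    using assms by (simp_all add: fun_eq_iff P_add nf_maps_range)
  moreover have "P2 e \<circ> (P2 e' \<circ> h) = P2 (e + e') \<circ> h" for h :: nf_map
    by (simp add: fun_eq_iff P2_def)
  ultimately show ?thesis
    using assms by (cases x) (simp_all add: swap_map_swap_map swap_map_nf_maps comp_gen_nf_maps)
qed

lemma H4_gen_0: "g \<in> nf_maps \<Longrightarrow> 0 < m \<Longrightarrow> H4_gen m x 0 g = g"
  by (cases x) (auto simp: fun_eq_iff P_0 nf_maps_range P2_def comp_def swap_map_swap_map)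

text \<open>Conjugation by \<open>swap_map\<close> exchanges \<open>a1\<close> with
  \<open>a3\<close> and \<open>a2\<close> with \<open>a4\<close>. It carries the relation between
  \<open>a1\<close> and \<open>a2\<close> to that between \<open>a3\<close> and \<open>a4\<close>,
  and the one between \<open>a2\<close> and \<open>a3\<close> to that between \<open>a4\<close> and
  \<open>a1\<close>.\<close>

lemma H4_gen_relation:
  assumes g: "g \<in> nf_maps" and m: "0 < m"
    and xy: "(x, y) \<in> {(a1, a2), (a2, a3), (a3, a4), (a4, a1)}"
  shows "H4_gen m y 1 (H4_gen m x 1 g) = H4_gen m x 1 (H4_gen m y (int m) g)"
proof -
  have r12: "P2 1 \<circ> (P1 m 1 \<circ> h) = P1 m 1 \<circ> (P2 (int m) \<circ> h)"
    and r23: "P3 m 1 \<circ> (P2 1 \<circ> h) = P2 1 \<circ> (P3 m (int m) \<circ> h)" if "h \<in> nf_maps" for h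
    using that m by (simp_all add: fun_eq_iff P_relations nf_maps_range)
  let ?t = "swap_map m"
  have t: "?t g \<in> nf_maps" using g m by (rule swap_map_nf_maps)
  consider "x = a1" "y = a2" | "x = a2" "y = a3" | "x = a3" "y = a4" | "x = a4" "y = a1" using xy by auto
  then show ?thesis
  proof cases
    case 1
    then show ?thesis using r12[OF g] by simp
  next
    case 2
    then show ?thesis using r23[OF g] by simp
  next
    case 3
    have "?t (P2 1 \<circ> ?t (P3 m 1 \<circ> g)) = ?t (P2 1 \<circ> (P1 m 1 \<circ> ?t g))"
      using g m by (simp add: swap_map_gen)
    also have "\<dots> = P3 m 1 \<circ> ?t (P2 (int m) \<circ> ?t g)"
      using t m by (simp add: r12 swap_map_gen comp_gen_nf_maps)
    finally show ?thesis using 3 by simp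
  next
    case 4
    have "P1 m 1 \<circ> ?t (P2 1 \<circ> ?t g) = ?t (P3 m 1 \<circ> (P2 1 \<circ> ?t g))"
      using t m by (simp add: swap_map_gen comp_gen_nf_maps)
    also have "\<dots> = ?t (P2 1 \<circ> ?t (P1 m (int m) \<circ> g))"
      using t g m by (simp add: r23 swap_map_gen)
    finally show ?thesis using 4 by simp
  qed
qed

lemma word_act_simps:
  "word_act m [] g = g" "word_act m (u @ v) g = word_act m u (word_act m v g)"
  "word_act m (x # v) g = letter_act m x (word_act m v g)"
  by (simp_all add: word_act_def)

lemma word_act_closed: "g \<in> nf_maps \<Longrightarrow> 0 < m \<Longrightarrow> word_act m w g \<in> nf_maps"
proof (induction w)
  case (Cons x w)
  then show ?case by (cases x) (simp_all add: word_act_simps H4_gen_closed)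
qed (simp add: word_act_simps)

lemma word_act_replicate:
  "g \<in> nf_maps \<Longrightarrow> 0 < m \<Longrightarrow> word_act m (replicate k (Pos x)) g = H4_gen m x (int k) g"
  by (induction k) (simp_all add: word_act_simps H4_gen_0 H4_gen_add add.commute)

lemma word_act_H4_relations:
  assumes "(l, r) \<in> H4_relations m" "g \<in> nf_maps" "0 < m"
  shows "word_act m l g = word_act m r g"
proof -
  obtain x y where xy: "(x, y) \<in> {(a1, a2), (a2, a3), (a3, a4), (a4, a1)}"
    and lr: "l = [Neg x, Pos y, Pos x]" "r = replicate m (Pos y)"
    using assms(1) unfolding H4_relations_def by blast
  have "H4_gen m x (- 1) (H4_gen m y 1 (H4_gen m x 1 g)) = H4_gen m y (int m) g"
    unfolding H4_gen_relation[OF assms(2,3) xy]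
    using assms by (simp add: H4_gen_add H4_gen_closed H4_gen_0)
  then show ?thesis using assms by (simp add: lr word_act_replicate) (simp add: word_act_simps)
qed

lemma word_act_word_eq:
  assumes "word_eq (H4_relations m) u v" "0 < m" "g \<in> nf_maps"
  shows "word_act m u g = word_act m v g"
  using assms
proof (induction arbitrary: g rule: word_eq.induct)
  case (relation l r u v)
  then show ?case by (simp add: word_act_simps word_act_H4_relations word_act_closed)
next
  case (cancel_pos u a v)
  then show ?case by (simp add: word_act_simps H4_gen_add H4_gen_0 word_act_closed)
next
  case (cancel_neg u a v)
  then show ?case by (simp add: word_act_simps H4_gen_add H4_gen_0 word_act_closed)
qed simp_all

text \<open>For \<open>a1\<close> and \<open>a3\<close> a one-letter reduced word moves the empty
  normal form; \<open>a2\<close> shifts the leading integer; \<open>a4\<close> is conjugate to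
  \<open>a2\<close>.\<close>

lemma H4_generator_infinite_order:
  assumes m: "0 < m" and eq: "word_eq (H4_relations m) (replicate k (Pos x)) []"
  shows "k = 0"
proof (rule ccontr)
  assume k: "k \<noteq> 0"
  obtain g where g: "g \<in> nf_maps" using nf_maps_nonempty by blast
  have fixed: "H4_gen m x (int k) g = g"
    using word_act_word_eq[OF eq m g] g m by (simp add: word_act_replicate word_act_simps)
  have base: "(0, []) \<in> normal_forms" by (simp add: normal_forms_def)
  have not13: "\<not> (\<forall>\<omega>\<in>normal_forms. eval13 m [(b, int k)] \<omega> = id \<omega>)" for b
    using reduced13_starts[of "[(b, int k)]" m] k m base by (cases b) fastforce+
  have not2: "P2 (int k) \<circ> h \<noteq> h" for h :: nf_map
    using k by (metis P2_def add_cancel_left_right comp_apply fst_conv of_nat_eq_0_iff)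
  have ev: "eval13 m [(False, e)] = P1 m e" "eval13 m [(True, e)] = P3 m e" for e
    by (auto simp: eval13_def gen13_def)
  show False
  proof (cases x)
    case a1
    then have "eval13 m [(False, int k)] \<circ> g = id \<circ> g" using fixed by (simp add: ev)
    then show False using not13 comp_nf_maps_eq_iff[OF g] by blast
  next
    case a2
    then show False using fixed not2 by simp
  next
    case a3
    then have "eval13 m [(True, int k)] \<circ> g = id \<circ> g" using fixed by (simp add: ev)
    then show False using not13 comp_nf_maps_eq_iff[OF g] by blast
  next
    case a4
    then have "swap_map m (swap_map m (P2 (int k) \<circ> swap_map m g)) = swap_map m g"
      using fixed by simp
    then show False
      using not2 swap_map_swap_map[OF comp_gen_nf_maps(2)[OF swap_map_nf_maps[OF g m] m] m] by metis
  qed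
qed

section \<open>Sofic approximations\<close>

text \<open>If \<open>b\<^sup>k\<close> is a power of \<open>a\<close> then it commutes with \<open>a\<close>, so \<open>b\<^sup>k = b\<^sup>m\<^sup>k\<close> and \<open>k = 0\<close>.\<close>

lemma (in group) bs_distinct:
  fixes i j i' j' m :: nat
  assumes a: "a \<in> carrier G" and b: "b \<in> carrier G" and rel: "b \<otimes> a = a \<otimes> b [^] m" and m: "2 \<le> m"
    and inf: "\<And>k::nat. a [^] k = \<one> \<Longrightarrow> k = 0" "\<And>k::nat. b [^] k = \<one> \<Longrightarrow> k = 0"
    and eq: "a [^] i \<otimes> b [^] j = a [^] i' \<otimes> b [^] j'"
  shows "i = i' \<and> j = j'"
proof -
  have push: "b [^] k \<otimes> a = a \<otimes> b [^] (m * k)" for k :: nat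
  proof (induction k)
    case (Suc k)
    have "b [^] Suc k \<otimes> a = b [^] k \<otimes> (b \<otimes> a)" using a b by (simp add: m_assoc)
    also have "\<dots> = (b [^] k \<otimes> a) \<otimes> b [^] m" using a b rel by (simp add: m_assoc)
    also have "\<dots> = a \<otimes> b [^] (m * Suc k)"
      using a b Suc by (simp add: m_assoc nat_pow_mult add.commute)
    finally show ?case .
  qed (use a in simp)
  have comm_0: "k = 0" if "b [^] k \<otimes> a = a \<otimes> b [^] k" for k :: nat
  proof -
    have "b [^] (m * k) = b [^] k" using that push[of k] a b by simp
    moreover have "b [^] (m * k) = b [^] k \<otimes> b [^] ((m - 1) * k)"
      using m b by (simp add: nat_pow_mult algebra_simps)
    ultimately have "b [^] ((m - 1) * k) = \<one>" using b by simp
    then show "k = 0" using inf(2) m by fastforce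
  qed
  have ordered: "i = i' \<and> j = j'"
    if le: "i' \<le> i" and eq: "a [^] i \<otimes> b [^] j = a [^] i' \<otimes> b [^] j'" for i i' j j' :: nat
  proof -
    define d where "d = i - i'"
    have "a [^] i = a [^] i' \<otimes> a [^] d" using le a by (simp add: d_def nat_pow_mult)
    then have "a [^] i' \<otimes> (a [^] d \<otimes> b [^] j) = a [^] i' \<otimes> b [^] j'"
      using eq a b by (simp add: m_assoc)
    then have d: "a [^] d \<otimes> b [^] j = b [^] j'" using a b by (simp add: Units_l_cancel)
    have ad: "a [^] d \<otimes> a = a \<otimes> a [^] d" using a by (metis nat_pow_Suc nat_pow_Suc2)
    have "j = j'"
    proof (cases "j \<le> j'")
      case True
      then have "b [^] j' = b [^] (j' - j) \<otimes> b [^] j" using b by (simp add: nat_pow_mult)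
      then have "a [^] d \<otimes> b [^] j = b [^] (j' - j) \<otimes> b [^] j" using d by simp
      then have "a [^] d = b [^] (j' - j)" using a b by simp
      from ad[unfolded this] have "j' - j = 0" by (rule comm_0)
      then show ?thesis using True by simp
    next
      case False
      let ?c = "b [^] (j - j')"
      have "b [^] j = ?c \<otimes> b [^] j'" using False b by (simp add: nat_pow_mult)
      then have "(a [^] d \<otimes> ?c) \<otimes> b [^] j' = \<one> \<otimes> b [^] j'" using d a b by (simp add: m_assoc)
      then have one: "a [^] d \<otimes> ?c = \<one>" using a b by (simp only: right_cancel m_closed nat_pow_closed one_closed)
      \<comment> \<open>\<open>?c\<close> is inverse to a power of \<open>a\<close>, hence commutes
        with \<open>a\<close>; cancelling \<open>a [^] d\<close> on the left shows this without
        inverses.\<close>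
      have "a [^] d \<otimes> (?c \<otimes> a) = (a [^] d \<otimes> ?c) \<otimes> a" using a b by (simp add: m_assoc)
      also have "\<dots> = a \<otimes> (a [^] d \<otimes> ?c)" using a one by simp
      also have "\<dots> = (a \<otimes> a [^] d) \<otimes> ?c" using a b by (simp add: m_assoc)
      also have "\<dots> = a [^] d \<otimes> (a \<otimes> ?c)" unfolding ad[symmetric] using a b by (simp add: m_assoc)
      finally have "?c \<otimes> a = a \<otimes> ?c" using a b by simp
      then have "j - j' = 0" by (rule comm_0)
      then show ?thesis using False by simp
    qed
    moreover from this have "a [^] d \<otimes> b [^] j' = \<one> \<otimes> b [^] j'" using d b by simp
    then have "a [^] d = \<one>" using a b by (simp only: right_cancel nat_pow_closed one_closed)
    then have "d = 0" by (rule inf(1))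
    ultimately show ?thesis using le by (simp add: d_def)
  qed
  show ?thesis
    using ordered[of i' i j j'] ordered[of i i' j' j] eq by (cases "i' \<le> i") auto
qed

section \<open>From sofic approximations to almost actions\<close>

fun next_gen :: "gen4 \<Rightarrow> gen4" where
  "next_gen a1 = a2" | "next_gen a2 = a3" | "next_gen a3 = a4" | "next_gen a4 = a1"

lemma H4_relation_word_eq:
  "word_eq (H4_relations m) [Pos (next_gen x), Pos x] (Pos x # replicate m (Pos (next_gen x)))"
proof -
  let ?y = "next_gen x" and ?R = "H4_relations m"
  have "([Neg x, Pos ?y, Pos x], replicate m (Pos ?y)) \<in> ?R"
    by (cases x) (auto simp: H4_relations_def)
  from word_eq.relation[OF this, of "[Pos x]" "[]"]
  have "word_eq ?R [Pos x, Neg x, Pos ?y, Pos x] (Pos x # replicate m (Pos ?y))" by simp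
  moreover have "word_eq ?R [Pos x, Neg x, Pos ?y, Pos x] [Pos ?y, Pos x]"
    using word_eq.cancel_pos[of ?R "[]" x "[Pos ?y, Pos x]"] by simp
  ultimately show ?thesis by (meson word_eq.sym word_eq.trans)
qed

lemma word_class_replicate:
  "word_class R (replicate k l) = word_class R [l] [^]\<^bsub>presented_group R\<^esub> (k::nat)"
proof (induction k)
  case 0
  show ?case using group_presented_group[of R]
    by (simp add: group.is_monoid monoid.nat_pow_0) (simp add: presented_group_def)
next
  case (Suc k)
  have "word_class R (replicate (Suc k) l) = word_class R (replicate k l @ [l])"
    by (simp add: replicate_append_same)
  also have "\<dots> = word_class R (replicate k l) \<otimes>\<^bsub>presented_group R\<^esub> word_class R [l]"
    by (simp add: mult_word_class)
  finally show ?case using Suc group_presented_group[of R]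
    by (simp add: group.is_monoid monoid.nat_pow_Suc)
qed

lemma H4_distinct:
  assumes m: "2 \<le> m"
    and eq: "word_eq (H4_relations m) (replicate i (Pos x) @ replicate j (Pos (next_gen x)))
      (replicate i' (Pos x) @ replicate j' (Pos (next_gen x)))"
  shows "i = i' \<and> j = j'"
proof -
  let ?R = "H4_relations m"
  let ?G = "presented_group ?R"
  let ?c = "\<lambda>x. word_class ?R [Pos x]"
  interpret group ?G by (rule group_presented_group)
  have one: "\<one>\<^bsub>?G\<^esub> = word_class ?R []" by (simp add: presented_group_def)
  have closed: "?c y \<in> carrier ?G" for y by (simp add: presented_group_def)
  have inf: "k = 0" if "?c y [^]\<^bsub>?G\<^esub> k = \<one>\<^bsub>?G\<^esub>" for y and k :: nat
    using that H4_generator_infinite_order[of m k y] m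
    by (simp add: one word_class_eq_iff flip: word_class_replicate)
  have rel: "?c (next_gen x) \<otimes>\<^bsub>?G\<^esub> ?c x = ?c x \<otimes>\<^bsub>?G\<^esub> ?c (next_gen x) [^]\<^bsub>?G\<^esub> m"
    using H4_relation_word_eq[of m x]
    by (simp add: mult_word_class word_class_eq_iff flip: word_class_replicate)
  show ?thesis
    using bs_distinct[OF closed closed rel m, where i = i and j = j and i' = i' and j' = j'] inf eq
    by (simp add: mult_word_class word_class_eq_iff flip: word_class_replicate)
qed

lemma real_card_subset_Un:
  assumes "A \<subseteq> B \<union> C" "finite B" "finite C"
  shows "real (card A) \<le> real (card B) + real (card C)"
proof -
  have "card A \<le> card (B \<union> C)" using assms by (intro card_mono) auto
  also have "\<dots> \<le> card B + card C" by (rule card_Un_le)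
  finally show ?thesis by linarith
qed

lemma UNIV_gen4: "(UNIV :: gen4 set) = {a1, a2, a3, a4}"
  by (auto intro: gen4.exhaust)

lemma finite_gen4 [simp]: "finite (UNIV :: gen4 set)"
  unfolding UNIV_gen4 by simp

lemma finite_gen4_letters: "finite (UNIV :: gen4 letter set)"
proof -
  have "(UNIV :: gen4 letter set) = range Pos \<union> range Neg"
    by (metis UNIV_eq_I Un_iff letter.exhaust rangeI)
  then show ?thesis by (metis finite_UnI finite_imageI finite_gen4)
qed

text \<open>Words of bounded length represent finitely many elements, and this set contains every
  product needed later. Distance from the identity is restated as scarcity of fixed points.\<close>

lemma sofic_H4_words:
  fixes \<delta> :: real
  assumes sofic: "sofic (H4 m)" and \<delta>: "0 < \<delta>"
  shows "\<exists>n::nat. n > 0 \<and> (\<exists>\<psi> :: gen4 letter list \<Rightarrow> nat \<Rightarrow> nat.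
    (\<forall>w. length w \<le> l \<longrightarrow> \<psi> w permutes {1..n}) \<and>
    (\<forall>u v. length u \<le> l \<longrightarrow> length v \<le> l \<longrightarrow> word_eq (H4_relations m) u v \<longrightarrow> \<psi> u = \<psi> v) \<and>
    (\<forall>u v. length (u @ v) \<le> l \<longrightarrow> real (card {i \<in> {1..n}. \<psi> (u @ v) i \<noteq> \<psi> u (\<psi> v i)}) \<le> \<delta> * n) \<and>
    (\<forall>w. length w \<le> l \<longrightarrow> \<not> word_eq (H4_relations m) w [] \<longrightarrow> real (card {i \<in> {1..n}. \<psi> w i = i}) \<le> \<delta> * n))"
proof -
  let ?R = "H4_relations m"
  let ?S = "word_class ?R ` {w. length w \<le> l}"
  have "finite {w :: gen4 letter list. length w \<le> l}"
    using finite_lists_length_le[OF finite_gen4_letters] by simp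
  moreover have "?S \<subseteq> carrier (H4 m)" by (auto simp: H4_def presented_group_def)
  ultimately obtain n \<phi> where n: "n > 0" and \<phi>: "sofic_approximation (H4 m) ?S \<delta> n \<phi>"
    using sofic \<delta> unfolding sofic_def by (metis finite_imageI)
  define \<psi> where "\<psi> w = \<phi> (word_class ?R w)" for w
  have S: "word_class ?R w \<in> ?S" if "length w \<le> l" for w using that by blast
  have perm: "\<psi> w permutes {1..n}" if "length w \<le> l" for w
  proof -
    have "\<psi> w \<in> carrier (sym_group n)"
      using \<phi> S[OF that] unfolding sofic_approximation_def \<psi>_def by blast
    then show ?thesis by (simp add: sym_group_def)
  qed
  have eq: "\<psi> u = \<psi> v" if "word_eq ?R u v" for u v
    using that by (simp add: \<psi>_def flip: word_class_eq_iff)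
  have mult: "real (card {i \<in> {1..n}. \<psi> (u @ v) i \<noteq> \<psi> u (\<psi> v i)}) \<le> \<delta> * n" if "length (u @ v) \<le> l" for u v
  proof -
    have prod: "word_class ?R u \<otimes>\<^bsub>H4 m\<^esub> word_class ?R v = word_class ?R (u @ v)"
      by (simp add: H4_def mult_word_class)
    have "word_class ?R u \<in> ?S" "word_class ?R v \<in> ?S" "word_class ?R (u @ v) \<in> ?S"
      using that by (auto intro!: S)
    then have "hamming_dist n (\<psi> u \<otimes>\<^bsub>sym_group n\<^esub> \<psi> v) (\<psi> (u @ v)) < \<delta>"
      using \<phi> prod unfolding sofic_approximation_def \<psi>_def by metis
    then have "real (card {i \<in> {1..n}. \<psi> u (\<psi> v i) \<noteq> \<psi> (u @ v) i}) < \<delta> * n"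
      using n by (simp add: hamming_dist_def sym_group_def field_simps)
    moreover have "{i \<in> {1..n}. \<psi> u (\<psi> v i) \<noteq> \<psi> (u @ v) i} = {i \<in> {1..n}. \<psi> (u @ v) i \<noteq> \<psi> u (\<psi> v i)}" by auto
    ultimately show ?thesis by simp
  qed
  have free: "real (card {i \<in> {1..n}. \<psi> w i = i}) \<le> \<delta> * n" if "length w \<le> l" "\<not> word_eq ?R w []" for w
  proof -
    have "word_class ?R w \<noteq> \<one>\<^bsub>H4 m\<^esub>"
      using that by (simp add: H4_def presented_group_def word_class_eq_iff)
    then have "hamming_dist n (\<psi> w) \<one>\<^bsub>sym_group n\<^esub> > 1 - \<delta>"
      using \<phi> S[OF that(1)] unfolding sofic_approximation_def \<psi>_def by blast
    then have "real (card {i \<in> {1..n}. \<psi> w i \<noteq> i}) > (1 - \<delta>) * n"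
      using n by (simp add: hamming_dist_def sym_group_def field_simps)
    moreover have "card ({i \<in> {1..n}. \<psi> w i \<noteq> i} \<union> {i \<in> {1..n}. \<psi> w i = i})
        = card {i \<in> {1..n}. \<psi> w i \<noteq> i} + card {i \<in> {1..n}. \<psi> w i = i}"
      by (rule card_Un_disjoint) auto
    moreover have "{i \<in> {1..n}. \<psi> w i \<noteq> i} \<union> {i \<in> {1..n}. \<psi> w i = i} = {1..n}" by auto
    ultimately show ?thesis by (simp add: algebra_simps)
  qed
  show ?thesis using n perm eq mult free by blast
qed

lemma letter_inv_letter_inv [simp]: "letter_inv (letter_inv x) = x"
  by (cases x) auto

lemma sofic_H4_almost_bs:
  fixes \<delta> :: real
  assumes sofic: "sofic (H4 m)" and m: "2 \<le> m" and \<delta>: "0 < \<delta>"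
  shows "\<exists>n::nat. n > 0 \<and> (\<exists>p :: gen4 \<Rightarrow> nat \<Rightarrow> nat. \<forall>x. almost_bs m L \<delta> {1..n} (p x) (p (next_gen x)))"
proof -
  let ?R = "H4_relations m"
  \<comment> \<open>The relation uses words of lengths 2 and m + 1; comparing two box elements uses
    words of length up to 6 L. The constant \<open>C\<close> below exceeds both accumulated error
    counts, m + 5 and 4 L + 4.\<close>
  define l where "l = m + 2 + 6 * L"
  define C where "C = real (2 * l + 4)"
  define \<delta>' where "\<delta>' = \<delta> / C"
  have C: "0 < C" by (simp add: C_def)
  then have \<delta>': "0 < \<delta>'" using \<delta> by (simp add: \<delta>'_def)
  obtain n :: nat and \<psi> :: "gen4 letter list \<Rightarrow> nat \<Rightarrow> nat" where n: "n > 0"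
    and perm: "\<And>w. length w \<le> l \<Longrightarrow> \<psi> w permutes {1..n}"
    and eq: "\<And>u v. length u \<le> l \<Longrightarrow> length v \<le> l \<Longrightarrow> word_eq ?R u v \<Longrightarrow> \<psi> u = \<psi> v"
    and mult: "\<And>u v. length (u @ v) \<le> l \<Longrightarrow> real (card {i \<in> {1..n}. \<psi> (u @ v) i \<noteq> \<psi> u (\<psi> v i)}) \<le> \<delta>' * n"
    and free: "\<And>w. length w \<le> l \<Longrightarrow> \<not> word_eq ?R w [] \<Longrightarrow> real (card {i \<in> {1..n}. \<psi> w i = i}) \<le> \<delta>' * n"
    using sofic_H4_words[OF sofic \<delta>', of l] by blast
  define c where "c w = foldr (\<lambda>x. \<psi> [x]) w" for w
  define p where "p x = \<psi> [Pos x]" for x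
  have c: "real (card {i \<in> {1..n}. \<psi> w i \<noteq> c w i}) \<le> (length w + 1) * (\<delta>' * n)" if "length w \<le> l" for w
    using that
  proof (induction w)
    \<comment> \<open>The approximation need not send the identity to the identity, but \<psi> [] is
      injective and almost idempotent, hence almost the identity.\<close>
    case Nil
    have "inj (\<psi> [])" using perm[of "[]"] by (simp add: permutes_inj)
    then have "{i \<in> {1..n}. \<psi> [] i \<noteq> c [] i} \<subseteq> {i \<in> {1..n}. \<psi> ([] @ []) i \<noteq> \<psi> [] (\<psi> [] i)}"
      by (auto simp: c_def inj_eq)
    then have "card {i \<in> {1..n}. \<psi> [] i \<noteq> c [] i} \<le> card {i \<in> {1..n}. \<psi> ([] @ []) i \<noteq> \<psi> [] (\<psi> [] i)}"
      by (intro card_mono) auto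
    then show ?case using mult[of "[]" "[]"] by simp
  next
    case (Cons x w)
    have "{i \<in> {1..n}. \<psi> (x # w) i \<noteq> c (x # w) i}
        \<subseteq> {i \<in> {1..n}. \<psi> ([x] @ w) i \<noteq> \<psi> [x] (\<psi> w i)} \<union> {i \<in> {1..n}. \<psi> w i \<noteq> c w i}"
      by (auto simp: c_def)
    from real_card_subset_Un[OF this] show ?case
      using mult[of "[x]" w] Cons by (simp add: algebra_simps)
  qed
  have c_rep: "c (replicate i (Pos x) @ replicate j (Pos y)) = bs_act (p x) (p y) (i, j)" for i j x y
  proof -
    have "foldr (\<lambda>x. \<psi> [x]) (replicate k (Pos x)) = p x ^^ k" for k x
      by (induction k) (simp_all add: p_def)
    then show ?thesis by (simp add: c_def bs_act_def fun_eq_iff)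
  qed
  show ?thesis
  proof (intro exI[of _ n] exI[of _ p] conjI n allI)
    fix x
    let ?y = "next_gen x"
    have 1: "1 \<le> l" by (simp add: l_def)
    have bij: "bij_betw (p z) {1..n} {1..n}" for z
      using perm[of "[Pos z]"] 1 by (simp add: p_def permutes_imp_bij)
    have bound: "real k * (\<delta>' * n) \<le> \<delta> * card {1..n}" if "k \<le> 2 * l + 4" for k
    proof -
      have "real k * (\<delta>' * n) \<le> C * (\<delta>' * n)"
        using that \<delta>' by (intro mult_right_mono) (simp_all add: C_def)
      also have "\<dots> = \<delta> * n" using C by (simp add: \<delta>'_def)
      finally show ?thesis by simp
    qed
    have rel: "real (card {i \<in> {1..n}. p ?y (p x i) \<noteq> p x ((p ?y ^^ m) i)}) \<le> \<delta> * card {1..n}"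
    proof -
      let ?u = "[Pos ?y, Pos x]" and ?v = "Pos x # replicate m (Pos ?y)"
      have len: "length ?u \<le> l" "length ?v \<le> l" by (simp_all add: l_def)
      have cu: "c ?u i = p ?y (p x i)" for i by (simp add: c_def p_def)
      have cv: "c ?v i = p x ((p ?y ^^ m) i)" for i
        using c_rep[of 1 x m ?y] by (simp add: bs_act_def)
      have "\<psi> ?u = \<psi> ?v" using eq[OF len] H4_relation_word_eq by blast
      then have "{i \<in> {1..n}. p ?y (p x i) \<noteq> p x ((p ?y ^^ m) i)}
          \<subseteq> {i \<in> {1..n}. \<psi> ?u i \<noteq> c ?u i} \<union> {i \<in> {1..n}. \<psi> ?v i \<noteq> c ?v i}"
        unfolding cu[symmetric] cv[symmetric] by auto
      from real_card_subset_Un[OF this]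
      have "real (card {i \<in> {1..n}. p ?y (p x i) \<noteq> p x ((p ?y ^^ m) i)}) \<le> real (m + 5) * (\<delta>' * n)"
        using c[OF len(1)] c[OF len(2)] by (simp add: algebra_simps)
      also have "\<dots> \<le> \<delta> * card {1..n}" by (rule bound) (simp add: l_def)
      finally show ?thesis .
    qed
    have coin: "real (card {i \<in> {1..n}. bs_act (p x) (p ?y) g i = bs_act (p x) (p ?y) h i}) \<le> \<delta> * card {1..n}"
      if gh: "g \<in> {..<L} \<times> {..<L}" "h \<in> {..<L} \<times> {..<L}" "g \<noteq> h" for g h
    proof -
      define w where "w g = replicate (fst g) (Pos x) @ replicate (snd g) (Pos ?y)" for g
      have cw: "c (w g) = bs_act (p x) (p ?y) g" for g by (simp add: w_def c_rep)
      \<comment> \<open>As a group element \<open>v\<close> is the quotient of the two box elements,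
        so a coincidence of their permutations is a fixed point of \<psi> v, apart from
        multiplicativity errors.\<close>
      define v where "v = rev (map letter_inv (w h)) @ w g"
      have len: "length (w g) \<le> 2 * L" "length (w h) \<le> 2 * L" using gh by (auto simp: w_def)
      then have lenl: "length (w g) \<le> l" "length (w h) \<le> l" "length v \<le> l" "length (w h @ v) \<le> l"
        by (simp_all add: l_def v_def)
      have "word_eq ?R (w h @ rev (map letter_inv (w h))) []"
        using word_eq_inverse[of ?R "rev (map letter_inv (w h))"] by (simp add: rev_map comp_def)
      from word_eq_append[OF this word_eq.refl[of ?R "w g"]]
      have hv: "word_eq ?R (w h @ v) (w g)" by (simp add: v_def)
      have "\<not> word_eq ?R v []"
      proof
        assume "word_eq ?R v []"
        from word_eq_append[OF word_eq.refl[of ?R "w h"] this]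
        have "word_eq ?R (w h @ v) (w h)" by simp
        with hv have "word_eq ?R (w g) (w h)" by (meson word_eq.sym word_eq.trans)
        then show False using H4_distinct[OF m] gh(3) unfolding w_def by (metis prod_eqI)
      qed
      note v = free[OF lenl(3) this]
      have eq': "\<psi> (w h @ v) = \<psi> (w g)" using eq lenl hv by blast
      have "inj (\<psi> (w h))" using perm[OF lenl(2)] by (rule permutes_inj)
      then have sub: "{i \<in> {1..n}. bs_act (p x) (p ?y) g i = bs_act (p x) (p ?y) h i}
          \<subseteq> ({i \<in> {1..n}. \<psi> (w g) i \<noteq> c (w g) i} \<union> {i \<in> {1..n}. \<psi> (w h) i \<noteq> c (w h) i}) \<union>
            ({i \<in> {1..n}. \<psi> (w h @ v) i \<noteq> \<psi> (w h) (\<psi> v i)} \<union> {i \<in> {1..n}. \<psi> v i = i})"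
        unfolding cw[symmetric] eq' by (auto simp: inj_eq)
      have "real (card {i \<in> {1..n}. bs_act (p x) (p ?y) g i = bs_act (p x) (p ?y) h i})
        \<le> (real (card {i \<in> {1..n}. \<psi> (w g) i \<noteq> c (w g) i}) + card {i \<in> {1..n}. \<psi> (w h) i \<noteq> c (w h) i}) +
          (real (card {i \<in> {1..n}. \<psi> (w h @ v) i \<noteq> \<psi> (w h) (\<psi> v i)}) + card {i \<in> {1..n}. \<psi> v i = i})"
        using real_card_subset_Un[OF sub] real_card_subset_Un[OF order_refl, of "{i \<in> {1..n}. \<psi> (w g) i \<noteq> c (w g) i}" "{i \<in> {1..n}. \<psi> (w h) i \<noteq> c (w h) i}"]
          real_card_subset_Un[OF order_refl, of "{i \<in> {1..n}. \<psi> (w h @ v) i \<noteq> \<psi> (w h) (\<psi> v i)}" "{i \<in> {1..n}. \<psi> v i = i}"]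
        by simp
      also have "\<dots> \<le> ((2 * L + 1) * (\<delta>' * n) + (2 * L + 1) * (\<delta>' * n)) + (\<delta>' * n + \<delta>' * n)"
      proof -
        have "real (card {i \<in> {1..n}. \<psi> (w z) i \<noteq> c (w z) i}) \<le> (2 * L + 1) * (\<delta>' * n)"
          if "length (w z) \<le> 2 * L" "length (w z) \<le> l" for z
        proof -
          have "real (length (w z) + 1) \<le> real (2 * L + 1)" using that(1) by simp
          then have "(length (w z) + 1) * (\<delta>' * n) \<le> (2 * L + 1) * (\<delta>' * n)"
            using \<delta>' by (intro mult_right_mono) auto
          then show ?thesis using c[OF that(2)] by linarith
        qed
        then show ?thesis using mult[OF lenl(4)] v len lenl by (intro add_mono)
      qed
      also have "\<dots> = real (4 * L + 4) * (\<delta>' * n)" by (simp add: algebra_simps)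
      also have "\<dots> \<le> \<delta> * card {1..n}" by (rule bound) (simp add: l_def)
      finally show ?thesis .
    qed
    show "almost_bs m L \<delta> {1..n} (p x) (p ?y)"
      unfolding almost_bs_def using bij rel coin by blast
  qed
qed

section \<open>Cyclic copies of a sofic approximation\<close>

definition copies :: "(gen4 \<Rightarrow> nat \<Rightarrow> nat) \<Rightarrow> (nat \<times> gen4 \<times> nat) + nat \<Rightarrow> (nat \<times> gen4 \<times> nat) + nat"
  where "copies p z = (case z of Inl (i, x, c) \<Rightarrow> Inl (p x i, x, c) | Inr j \<Rightarrow> Inr j)"

definition rotate_copies :: "(nat \<times> gen4 \<times> nat) + nat \<Rightarrow> (nat \<times> gen4 \<times> nat) + nat"
  where "rotate_copies z = (case z of Inl (i, x, c) \<Rightarrow> Inl (i, next_gen x, c) | Inr j \<Rightarrow> Inr j)"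

text \<open>A point \<open>Inl (i, x, c)\<close> lies in the \<open>c\<close>-th copy of the shift
  starting at generator \<open>x\<close>. The \<open>Inr\<close> points are padding fixed by every
  map, there to reach an arbitrary cardinality.\<close>

definition copies_space :: "nat \<Rightarrow> nat \<Rightarrow> nat \<Rightarrow> ((nat \<times> gen4 \<times> nat) + nat) set"
  where "copies_space k q r = ({1..k} \<times> UNIV \<times> {..<q}) <+> {..<r}"

lemma card_gen4: "card (UNIV :: gen4 set) = 4"
  unfolding UNIV_gen4 by simp

lemma finite_copies_space [simp]: "finite (copies_space k q r)"
  by (simp add: copies_space_def)

lemma card_copies_space: "card (copies_space k q r) = 4 * k * q + r"
  by (simp add: copies_space_def card_Plus card_cartesian_product card_gen4)

lemma card_copies_space_le:
  fixes s :: real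
  assumes "\<And>x c. real (card {i \<in> {1..k}. P (Inl (i, x, c))}) \<le> s"
  shows "real (card {z \<in> copies_space k q r. P z}) \<le> 4 * q * s + r"
proof -
  let ?I = "(UNIV :: gen4 set) \<times> {..<q}"
  let ?E = "\<lambda>t. (\<lambda>i. Inl (i, t)) ` {i \<in> {1..k}. P (Inl (i, t))} :: ((nat \<times> gen4 \<times> nat) + nat) set"
  have "{z \<in> copies_space k q r. P z} \<subseteq> (\<Union>t\<in>?I. ?E t) \<union> Inr ` {..<r}"
    by (auto simp: copies_space_def)
  from real_card_subset_Un[OF this]
  have "real (card {z \<in> copies_space k q r. P z}) \<le> real (card (\<Union>t\<in>?I. ?E t)) + real (card (Inr ` {..<r} :: ((nat \<times> gen4 \<times> nat) + nat) set))"
    by simp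
  also have "card (Inr ` {..<r} :: ((nat \<times> gen4 \<times> nat) + nat) set) = r" by (simp add: card_image)
  also have "real (card (\<Union>t\<in>?I. ?E t)) \<le> real (\<Sum>t\<in>?I. card (?E t))"
    by (simp only: of_nat_le_iff) (rule card_UN_le, simp)
  also have "real (\<Sum>t\<in>?I. card (?E t)) = (\<Sum>t\<in>?I. real (card (?E t)))" by simp
  also have "\<dots> \<le> (\<Sum>t\<in>?I. s)"
  proof (intro sum_mono)
    fix t
    have "card (?E t) \<le> card {i \<in> {1..k}. P (Inl (i, t))}" by (rule card_image_le) simp
    then show "real (card (?E t)) \<le> s" using assms[of "fst t" "snd t"] by simp
  qed
  also have "\<dots> = 4 * q * s" by (simp add: card_cartesian_product card_gen4)
  finally show ?thesis by simp
qed

lemma bij_betw_copies: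
  assumes "\<And>x. bij_betw (p x) {1..k} {1..k}"
  shows "bij_betw (copies p) (copies_space k q r) (copies_space k q r)"
proof -
  have inj: "p x i = p x j \<longleftrightarrow> i = j" if "i \<in> {1..k}" "j \<in> {1..k}" for x i j
    using inj_on_eq_iff[OF bij_betw_imp_inj_on[OF assms[of x]] that] .
  have mem: "p x i \<in> {1..k}" if "i \<in> {1..k}" for x i using bij_betwE[OF assms[of x]] that by blast
  have "inj_on (copies p) (copies_space k q r)"
    using inj by (auto simp: inj_on_def copies_space_def copies_def)
  moreover have "copies p ` copies_space k q r \<subseteq> copies_space k q r"
    using mem by (auto simp: copies_space_def copies_def)
  ultimately show ?thesis by (simp add: bij_betw_def endo_inj_surj)
qed

lemma funpow_copies: "(copies p ^^ j) (Inl (i, x, c)) = Inl ((p x ^^ j) i, x, c)"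
  by (induction j) (simp_all add: copies_def)

text \<open>The padding points are counted as failures throughout, since fixed points violate
  freeness; doubling \<delta> pays for them.\<close>

lemma almost_bs_copies:
  fixes \<delta> :: real
  assumes bs: "\<And>x. almost_bs m L \<delta> {1..k} (p x) (p' x)" and \<delta>: "0 < \<delta>"
    and r: "r \<le> \<delta> * (4 * k * q + r)"
  shows "almost_bs m L (2 * \<delta>) (copies_space k q r) (copies p) (copies p')"
proof -
  have le: "4 * real q * (\<delta> * card {1..k}) + r \<le> 2 * \<delta> * card (copies_space k q r)"
  proof -
    have "2 * \<delta> * card (copies_space k q r) = \<delta> * (4 * k * q) + \<delta> * r + \<delta> * (4 * k * q + r)"
      by (simp add: card_copies_space algebra_simps)
    moreover have "0 \<le> \<delta> * r" using \<delta> by simp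
    ultimately show ?thesis using r by (simp add: algebra_simps)
  qed
  have act: "bs_act (copies p) (copies p') g (Inl (i, x, c)) = Inl (bs_act (p x) (p' x) g i, x, c)" for g i x c
    by (simp add: bs_act_def funpow_copies)
  have act1: "copies p (Inl (i, x, c)) = Inl (p x i, x, c)" "copies p' (Inl (i, x, c)) = Inl (p' x i, x, c)" for i x c
    by (simp_all add: copies_def)
  have count: "real (card {z \<in> copies_space k q r. P z}) \<le> 2 * \<delta> * real (card (copies_space k q r))"
    if "\<And>x c. real (card {i \<in> {1..k}. P (Inl (i, x, c))}) \<le> \<delta> * card {1..k}" for P
    using card_copies_space_le[of k P "\<delta> * card {1..k}" q r, OF that] le by linarith
  show ?thesis
    unfolding almost_bs_def
  proof (intro conjI ballI impI)
    show "bij_betw (copies p) (copies_space k q r) (copies_space k q r)"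
      "bij_betw (copies p') (copies_space k q r) (copies_space k q r)"
      using bs by (auto intro!: bij_betw_copies simp: almost_bs_def)
    show "real (card {z \<in> copies_space k q r. copies p' (copies p z) \<noteq> copies p ((copies p' ^^ m) z)})
        \<le> 2 * \<delta> * real (card (copies_space k q r))"
    proof (rule count)
      fix x c
      have "real (card {i \<in> {1..k}. p' x (p x i) \<noteq> p x ((p' x ^^ m) i)}) \<le> \<delta> * card {1..k}"
        using bs[of x] unfolding almost_bs_def by blast
      then show "real (card {i \<in> {1..k}. copies p' (copies p (Inl (i, x, c))) \<noteq> copies p ((copies p' ^^ m) (Inl (i, x, c)))})
          \<le> \<delta> * card {1..k}"
        by (simp only: act1 funpow_copies sum.inject prod.inject simp_thms)
    qed
    fix g h assume gh: "g \<in> {..<L} \<times> {..<L}" "h \<in> {..<L} \<times> {..<L}" "g \<noteq> h"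
    show "real (card {z \<in> copies_space k q r. bs_act (copies p) (copies p') g z = bs_act (copies p) (copies p') h z})
        \<le> 2 * \<delta> * real (card (copies_space k q r))"
    proof (rule count)
      fix x c
      have "real (card {i \<in> {1..k}. bs_act (p x) (p' x) g i = bs_act (p x) (p' x) h i}) \<le> \<delta> * card {1..k}"
        using bs[of x] gh unfolding almost_bs_def by blast
      then show "real (card {i \<in> {1..k}. bs_act (copies p) (copies p') g (Inl (i, x, c)) = bs_act (copies p) (copies p') h (Inl (i, x, c))})
          \<le> \<delta> * card {1..k}"
        by (simp only: act sum.inject prod.inject simp_thms)
    qed
  qed simp
qed

lemma next_gen_4 [simp]: "next_gen (next_gen (next_gen (next_gen x))) = x"
  by (cases x) auto

text \<open>Rotating the four cyclic shifts of one sofic approximation conjugates \<open>B\<close> to \<open>A\<close> exactly.\<close>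

lemma sofic_H4_cyclic:
  fixes \<delta> :: real
  assumes "sofic (H4 m)" "2 \<le> m" "0 < \<delta>"
  shows "\<exists>N. \<forall>n\<ge>N. \<exists>(X :: ((nat \<times> gen4 \<times> nat) + nat) set) A B f. card X = n \<and> almost_bs m L \<delta> X A B \<and>
    (\<forall>x\<in>X. f x \<in> X \<and> f (B x) = A (f x) \<and> f (f (f (f x))) = x)"
proof -
  obtain k :: nat and p where k: "k > 0" and bs: "\<And>x. almost_bs m L (\<delta> / 2) {1..k} (p x) (p (next_gen x))"
    using sofic_H4_almost_bs[OF assms(1,2) half_gt_zero[OF assms(3)], of L] by blast
  show ?thesis
  proof (intro exI[of _ "nat \<lceil>8 * k / \<delta>\<rceil>"] allI impI)
    fix n assume n: "nat \<lceil>8 * k / \<delta>\<rceil> \<le> n"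
    define q r where "q = n div (4 * k)" and "r = n mod (4 * k)"
    have nqr: "4 * k * q + r = n" by (simp add: q_def r_def)
    \<comment> \<open>The remainder is below 4 k, and this bound on n makes 4 k at most half of
      \<delta> n.\<close>
    have "8 * k / \<delta> \<le> n" using n by linarith
    then have "4 * k \<le> \<delta> / 2 * n" using assms(3) by (simp add: field_simps)
    moreover have "r < 4 * k" using k by (simp add: r_def)
    then have "real r \<le> 4 * k" by linarith
    ultimately have r: "r \<le> \<delta> / 2 * (4 * k * q + r)" unfolding nqr by linarith
    let ?X = "copies_space k q r" and ?A = "copies p" and ?B = "copies (\<lambda>x. p (next_gen x))"
    have "almost_bs m L (2 * (\<delta> / 2)) ?X ?A ?B"
      by (rule almost_bs_copies) (use bs assms(3) r in auto)
    moreover have "\<forall>z\<in>?X. rotate_copies z \<in> ?X \<and> rotate_copies (?B z) = ?A (rotate_copies z) \<and>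
        rotate_copies (rotate_copies (rotate_copies (rotate_copies z))) = z"
      by (auto simp: copies_space_def rotate_copies_def copies_def)
    moreover have "card ?X = n" by (simp add: card_copies_space nqr)
    ultimately show "\<exists>(X :: ((nat \<times> gen4 \<times> nat) + nat) set) A B f. card X = n \<and> almost_bs m L \<delta> X A B \<and>
      (\<forall>x\<in>X. f x \<in> X \<and> f (B x) = A (f x) \<and> f (f (f (f x))) = x)"
      by (intro exI[of _ ?X] exI[of _ ?A] exI[of _ ?B] exI[of _ rotate_copies]) simp
  qed
qed

section \<open>The model action on residues\<close>

text \<open>For solutions x the quotient (c x - e) / n is an integer that determines x, and it
  ranges over an interval with c + 1 integers.\<close>

lemma card_linear_congruence_le:
  fixes c e n :: int
  assumes "0 < c" "0 < n"
  shows "card {x \<in> {0..n - 1}. (c * x) mod n = e mod n} \<le> nat (c + 1)"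
proof -
  let ?S = "{x \<in> {0..n - 1}. (c * x) mod n = e mod n}"
  let ?t = "\<lambda>x. (c * x - e) div n"
  have dvd: "n * ?t x = c * x - e" if "x \<in> ?S" for x
    using that by (simp add: mod_eq_dvd_iff)
  have "inj_on ?t ?S"
  proof (rule inj_onI)
    fix x y assume xy: "x \<in> ?S" "y \<in> ?S" "?t x = ?t y"
    then have "c * x - e = c * y - e" using dvd[OF xy(1)] dvd[OF xy(2)] unfolding xy(3) by linarith
    then show "x = y" using assms by auto
  qed
  moreover have "?t ` ?S \<subseteq> {(- e) div n..c + (- e) div n}"
  proof
    fix t assume "t \<in> ?t ` ?S"
    then obtain x where x: "x \<in> ?S" "t = ?t x" by blast
    have "(- e) div n \<le> ?t x" using x assms by (intro zdiv_mono1) auto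
    moreover have "?t x \<le> (c * n + - e) div n"
      using x assms by (intro zdiv_mono1) (auto intro!: mult_left_mono)
    moreover have "(c * n + - e) div n = c + (- e) div n" using assms div_mult_self1[of n "- e" c] by (simp add: add.commute)
    ultimately show "t \<in> {(- e) div n..c + (- e) div n}" using x by simp
  qed
  ultimately have "card ?S \<le> card {(- e) div n..c + (- e) div n}"
    by (intro card_inj_on_le) auto
  then show ?thesis by simp
qed

text \<open>The relation holds exactly. Applying enough multiplications by m to a coincidence of two
  box elements turns it into (m^d - 1) x = e mod n, where d is the difference of the A-exponents.
  For d = 0 there is no solution because the B-exponents differ by less than n; otherwise there are
  at most m^d.\<close>

lemma almost_bs_residues:
  fixes \<delta> :: real and n m :: nat
  assumes \<delta>: "0 < \<delta>" and m: "2 \<le> m" and cop: "coprime n m"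
    and n: "0 < n" "L \<le> n" "m ^ L \<le> \<delta> * n"
  defines "M \<equiv> \<lambda>x. (int m * x) mod int n" and "Z \<equiv> {0..int n - 1}"
  shows "bij_betw M Z Z" "almost_bs m L \<delta> Z (inv_into Z M) (\<lambda>x. (x - 1) mod int n)"
proof -
  let ?A = "inv_into Z M" and ?B = "\<lambda>x. (x - 1) mod int n"
  have n': "0 < int n" using n by simp
  have finZ: "finite Z" by (simp add: Z_def)
  have modZ: "x mod int n \<in> Z" for x using n' by (simp add: Z_def)
  have Zmod: "x mod int n = x" if "x \<in> Z" for x using that by (simp add: Z_def)
  have "inj_on M Z"
  proof (rule inj_onI)
    fix x y assume xy: "x \<in> Z" "y \<in> Z" "M x = M y"
    then have "[int m * x = int m * y] (mod int n)" by (simp add: M_def cong_def)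
    then have "[x = y] (mod int n)" using cop by (simp add: cong_mult_lcancel coprime_commute)
    then show "x = y" using xy Zmod by (simp add: cong_def)
  qed
  moreover have "M ` Z \<subseteq> Z" using modZ by (auto simp: M_def)
  ultimately show bijM: "bij_betw M Z Z" by (simp add: bij_betw_def endo_inj_surj Z_def)
  have bijA: "bij_betw ?A Z Z" using bijM by (rule bij_betw_inv_into)
  have MA: "M (?A x) = x" if "x \<in> Z" for x using bijM that by (meson bij_betw_inv_into_right)
  have AM: "?A (M x) = x" if "x \<in> Z" for x using bijM that by (meson bij_betw_inv_into_left)
  have AZ: "?A x \<in> Z" if "x \<in> Z" for x using bijA that by (meson bij_betwE)
  have Bpow: "(?B ^^ j) x = (x - int j) mod int n" if "x \<in> Z" for x j
  proof (induction j)
    case (Suc j)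
    then show ?case by (simp add: mod_simps algebra_simps)
  qed (simp add: Zmod that)
  have Mpow: "(M ^^ j) x = (int m ^ j * x) mod int n" if "x \<in> Z" for x j
  proof (induction j)
    case (Suc j)
    then show ?case by (simp add: M_def mod_simps algebra_simps)
  qed (simp add: Zmod that)
  have Apow: "(?A ^^ j) x \<in> Z" if "x \<in> Z" for x j using that by (induction j) (auto intro: AZ)
  have MpowA: "(M ^^ (j + d)) ((?A ^^ j) x) = (M ^^ d) x" if "x \<in> Z" for x j d
  proof (induction j)
    case (Suc j)
    have "(M ^^ (Suc j + d)) ((?A ^^ Suc j) x) = (M ^^ (j + d)) (M (?A ((?A ^^ j) x)))"
      by (simp add: funpow_swap1)
    then show ?case using Suc MA Apow that by simp
  qed simp
  have bijB: "bij_betw ?B Z Z"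
    by (rule bij_betw_byWitness[of _ "\<lambda>x. (x + 1) mod int n"]) (use Zmod modZ in \<open>auto simp: mod_simps\<close>)
  have rel: "?B (?A x) = ?A ((?B ^^ m) x)" if x: "x \<in> Z" for x
  proof -
    have "M (?B (?A x)) = (int m * ?A x - int m) mod int n" by (simp add: M_def mod_simps algebra_simps)
    also have "\<dots> = (M (?A x) - int m) mod int n" by (simp add: M_def mod_simps)
    also have "\<dots> = (?B ^^ m) x" using MA Bpow x by simp
    finally show ?thesis using AM[OF modZ, of "?A x - 1"] by simp
  qed
  have coin: "real (card {x \<in> Z. bs_act ?A ?B g x = bs_act ?A ?B h x}) \<le> \<delta> * n"
    if gh: "g \<in> {..<L} \<times> {..<L}" "h \<in> {..<L} \<times> {..<L}" "g \<noteq> h" "fst g \<le> fst h" for g h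
  proof -
    define d where "d = fst h - fst g"
    define c where "c = int m ^ d - 1"
    let ?e = "int m ^ d * snd g - snd h"
    have sub: "{x \<in> Z. bs_act ?A ?B g x = bs_act ?A ?B h x} \<subseteq> {x \<in> Z. (c * x) mod int n = ?e mod int n}"
    proof clarify
      fix x assume x: "x \<in> Z" and eq: "bs_act ?A ?B g x = bs_act ?A ?B h x"
      have "(M ^^ fst h) (bs_act ?A ?B g x) = (M ^^ d) ((?B ^^ snd g) x)"
        using MpowA[of "(?B ^^ snd g) x" "fst g" d] gh(4) x modZ Bpow by (simp add: bs_act_def d_def)
      moreover have "(M ^^ fst h) (bs_act ?A ?B h x) = (?B ^^ snd h) x"
        using MpowA[of "(?B ^^ snd h) x" "fst h" 0] x modZ Bpow by (simp add: bs_act_def)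
      ultimately have "(M ^^ d) ((x - int (snd g)) mod int n) = (x - int (snd h)) mod int n"
        using eq Bpow x by simp
      then have "(int m ^ d * (x - int (snd g))) mod int n = (x - int (snd h)) mod int n"
        using Mpow[OF modZ] by (simp add: mod_simps)
      then have "int n dvd int m ^ d * (x - int (snd g)) - (x - int (snd h))" by (simp add: mod_eq_dvd_iff)
      then show "(c * x) mod int n = ?e mod int n" by (simp add: mod_eq_dvd_iff c_def algebra_simps)
    qed
    show ?thesis
    proof (cases "d = 0")
      case True
      have "{x \<in> Z. (c * x) mod int n = ?e mod int n} = {}"
      proof (rule ccontr)
        assume "\<not> ?thesis"
        then have "int n dvd int (snd g) - int (snd h)"
          using True by (auto simp: c_def)
        moreover have "\<bar>int (snd g) - int (snd h)\<bar> < int n" using gh n by auto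
        ultimately have "snd g = snd h" using dvd_imp_le_int[of "int (snd g) - int (snd h)" "int n"] by fastforce
        then show False using True gh d_def by (auto simp: prod_eq_iff)
      qed
      then have "{x \<in> Z. bs_act ?A ?B g x = bs_act ?A ?B h x} = {}" using sub by blast
      then show ?thesis using \<delta> by (simp only: card.empty) simp
    next
      case False
      have "1 < int m ^ d" using m False by simp
      then have c: "0 < c" by (simp add: c_def)
      have "card {x \<in> Z. bs_act ?A ?B g x = bs_act ?A ?B h x} \<le> card {x \<in> Z. (c * x) mod int n = ?e mod int n}"
        using sub finZ by (intro card_mono) auto
      also have "\<dots> \<le> nat (c + 1)" unfolding Z_def by (rule card_linear_congruence_le[OF c n'])
      also have "\<dots> = m ^ d" by (simp add: c_def nat_power_eq)
      also have "\<dots> \<le> m ^ L" using m gh by (intro power_increasing) (auto simp: d_def)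
      finally show ?thesis using n(3) by (smt (verit) of_nat_le_iff of_nat_power)
    qed
  qed
  have cardZ: "card Z = n" by (simp add: Z_def)
  have coin': "real (card {x \<in> Z. bs_act ?A ?B g x = bs_act ?A ?B h x}) \<le> \<delta> * n"
    if "g \<in> {..<L} \<times> {..<L}" "h \<in> {..<L} \<times> {..<L}" "g \<noteq> h" for g h
  proof (cases "fst g \<le> fst h")
    case True
    then show ?thesis using coin that by blast
  next
    case False
    have "{x \<in> Z. bs_act ?A ?B g x = bs_act ?A ?B h x} = {x \<in> Z. bs_act ?A ?B h x = bs_act ?A ?B g x}" by auto
    then show ?thesis using coin[of h g] that False by simp
  qed
  have "{x \<in> Z. ?B (?A x) \<noteq> ?A ((?B ^^ m) x)} = {}" using rel by blast
  then have "real (card {x \<in> Z. ?B (?A x) \<noteq> ?A ((?B ^^ m) x)}) \<le> \<delta> * n"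
    using \<delta> by (simp only: card.empty) simp
  then show "almost_bs m L \<delta> Z ?A ?B"
    unfolding almost_bs_def cardZ using bijA bijB coin' finZ by blast
qed

section \<open>Transport to the residue ring\<close>

lemma add_pow_residue_ring:
  assumes "x \<in> {0..int n - 1}"
  shows "[(k::nat)] \<cdot>\<^bsub>residue_ring (int n)\<^esub> x = (int k * x) mod int n"
proof (induction k)
  case 0
  show ?case by (simp add: add_pow_def nat_pow_def residue_ring_def)
next
  case (Suc k)
  have "[Suc k] \<cdot>\<^bsub>residue_ring (int n)\<^esub> x = [k] \<cdot>\<^bsub>residue_ring (int n)\<^esub> x \<oplus>\<^bsub>residue_ring (int n)\<^esub> x"
    by (simp add: add_pow_def nat_pow_def)
  also have "\<dots> = ((int k * x) mod int n + x) mod int n"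
    using Suc by (simp add: residue_ring_def)
  finally show ?case by (simp add: mod_simps algebra_simps)
qed

theorem theorem2:
  fixes m :: nat
  assumes "m \<ge> 2" and "sofic (H4 m)"
  shows "\<forall>\<epsilon>::real. \<epsilon> > 0 \<longrightarrow>
    (\<exists>N::nat. N > 0 \<and> (\<forall>n::nat. n \<ge> N \<and> coprime n m \<longrightarrow>
      (let Zn = residue_ring (int n) in
       \<exists>f. bij_betw f (carrier Zn) (carrier Zn) \<and>
           real (card {x \<in> carrier Zn. f (x \<oplus>\<^bsub>Zn\<^esub> \<one>\<^bsub>Zn\<^esub>) = [m] \<cdot>\<^bsub>Zn\<^esub> f x}) \<ge> (1 - \<epsilon>) * real n \<and>
           (\<forall>x\<in>carrier Zn. f (f (f (f x))) = x))))"
proof (intro allI impI)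
  fix \<epsilon> :: real assume \<epsilon>: "\<epsilon> > 0"
  \<comment> \<open>Half of \<epsilon> is requested because each bad point of the conjugation can
    spoil two equations.\<close>
  obtain L \<delta> where \<delta>: "0 < \<delta>" and conj: "\<forall>(X :: ((nat \<times> gen4 \<times> nat) + nat) set) A B (Y :: int set) A' B'.
      almost_bs m L \<delta> X A B \<longrightarrow> almost_bs m L \<delta> Y A' B' \<longrightarrow> card X = card Y \<longrightarrow>
      (\<exists>\<sigma>. bij_betw \<sigma> X Y \<and>
        card {x \<in> X. \<sigma> (A x) \<noteq> A' (\<sigma> x) \<or> \<sigma> (B x) \<noteq> B' (\<sigma> x)} \<le> \<epsilon> / 2 * card X)"
    using almost_bs_conjugate[OF half_gt_zero[OF \<epsilon>], of m] by (elim exE conjE)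
  obtain N1 where N1: "\<And>n. n \<ge> N1 \<Longrightarrow> \<exists>(X :: ((nat \<times> gen4 \<times> nat) + nat) set) A B f. card X = n \<and>
      almost_bs m L \<delta> X A B \<and> (\<forall>x\<in>X. f x \<in> X \<and> f (B x) = A (f x) \<and> f (f (f (f x))) = x)"
    using sofic_H4_cyclic[OF assms(2,1) \<delta>, of L] by blast
  define N where "N = N1 + L + 2 + nat \<lceil>m ^ L / \<delta>\<rceil>"
  show "\<exists>N::nat. N > 0 \<and> (\<forall>n::nat. n \<ge> N \<and> coprime n m \<longrightarrow>
      (let Zn = residue_ring (int n) in
       \<exists>f. bij_betw f (carrier Zn) (carrier Zn) \<and>
           real (card {x \<in> carrier Zn. f (x \<oplus>\<^bsub>Zn\<^esub> \<one>\<^bsub>Zn\<^esub>) = [m] \<cdot>\<^bsub>Zn\<^esub> f x}) \<ge> (1 - \<epsilon>) * real n \<and>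
           (\<forall>x\<in>carrier Zn. f (f (f (f x))) = x)))"
  proof (intro exI[of _ N] conjI allI impI)
    show "N > 0" by (simp add: N_def)
    fix n assume "n \<ge> N \<and> coprime n m"
    then have n: "n \<ge> N" and cop: "coprime n m" by auto
    have "m ^ L / \<delta> \<le> n" using n unfolding N_def by linarith
    then have mL: "m ^ L \<le> \<delta> * n" using \<delta> by (simp add: field_simps)
    have nbd: "n \<ge> N1" "0 < n" "L \<le> n" using n by (auto simp: N_def)
    define Z where "Z = {0..int n - 1}"
    define M where "M = (\<lambda>x. (int m * x) mod int n)"
    let ?A' = "inv_into Z M" and ?B' = "\<lambda>x. (x - 1) mod int n"
    note std = almost_bs_residues[OF \<delta> assms(1) cop nbd(2,3) mL, folded Z_def M_def]
    have cardZ: "card Z = n" and finZ: "finite Z" by (simp_all add: Z_def)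
    obtain X :: "((nat \<times> gen4 \<times> nat) + nat) set" and A B f where X: "card X = n" "almost_bs m L \<delta> X A B"
      and f: "\<And>x. x \<in> X \<Longrightarrow> f x \<in> X" "\<And>x. x \<in> X \<Longrightarrow> f (B x) = A (f x)" "\<And>x. x \<in> X \<Longrightarrow> f (f (f (f x))) = x"
      using N1[OF nbd(1)] by blast
    have finX: "finite X" and bijB: "bij_betw B X X" using X(2) by (auto simp: almost_bs_def)
    define bad where "bad \<sigma> x \<longleftrightarrow> \<sigma> (A x) \<noteq> ?A' (\<sigma> x) \<or> \<sigma> (B x) \<noteq> ?B' (\<sigma> x)" for \<sigma> x
    obtain \<sigma> where \<sigma>: "bij_betw \<sigma> X Z" and few: "card {x \<in> X. bad \<sigma> x} \<le> \<epsilon> / 2 * n"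
      using conj[rule_format, OF X(2) std(2)] X(1) cardZ unfolding bad_def by auto
    define g where "g = inv_into X \<sigma>"
    have g: "bij_betw g Z X" unfolding g_def using \<sigma> by (rule bij_betw_inv_into)
    have g\<sigma>: "g (\<sigma> x) = x" if "x \<in> X" for x using \<sigma> that unfolding g_def by (rule bij_betw_inv_into_left)
    have \<sigma>g: "\<sigma> (g y) = y" if "y \<in> Z" for y using \<sigma> that unfolding g_def by (rule bij_betw_inv_into_right)
    have gX: "g y \<in> X" if "y \<in> Z" for y using g that by (rule bij_betwE[rule_format])
    have \<sigma>Z: "\<sigma> x \<in> Z" if "x \<in> X" for x using \<sigma> that by (rule bij_betwE[rule_format])
    have bijf: "bij_betw f X X"
      by (rule bij_betw_byWitness[of _ "\<lambda>x. f (f (f x))"]) (use f in auto)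
    define F where "F y = \<sigma> (f (g y))" for y
    have F4: "F (F (F (F y))) = y" if "y \<in> Z" for y
      using that by (simp add: F_def g\<sigma> gX f \<sigma>g)
    have "bij_betw (\<sigma> \<circ> (f \<circ> g)) Z Z" using g bijf \<sigma> by (meson bij_betw_trans)
    moreover have "\<sigma> \<circ> (f \<circ> g) = F" by (simp add: fun_eq_iff F_def)
    ultimately have bijF: "bij_betw F Z Z" by simp
    have rec: "F ((y + 1) mod int n) = M (F y)" if y: "y \<in> Z" and ok: "\<not> bad \<sigma> (g ((y + 1) mod int n))"
      "\<not> bad \<sigma> (f (g ((y + 1) mod int n)))" for y
    proof -
      define z where "z = (y + 1) mod int n"
      have z: "z \<in> Z" using nbd by (simp add: z_def Z_def)
      have "?B' z = y" using y by (simp add: z_def mod_simps) (simp add: Z_def)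
      then have "y = \<sigma> (B (g z))" using ok(1) \<sigma>g[OF z] by (simp add: bad_def z_def)
      then have "g y = B (g z)" using g\<sigma> bijB gX[OF z] by (metis bij_betwE)
      then have "F y = \<sigma> (A (f (g z)))" using f(2) gX[OF z] by (simp add: F_def)
      also have "\<dots> = ?A' (\<sigma> (f (g z)))" using ok(2) by (simp add: bad_def z_def)
      finally have "F y = ?A' (F z)" by (simp add: F_def)
      moreover have "F z \<in> Z" using bijF z by (rule bij_betwE[rule_format])
      ultimately show ?thesis using bij_betw_inv_into_right[OF std(1)] by (simp add: z_def)
    qed
    let ?good = "{y \<in> Z. F ((y + 1) mod int n) = M (F y)}"
    \<comment> \<open>The equation at y is safe when both \<open>g z\<close> and
      \<open>f (g z)\<close> are not bad, where z = y + 1. Since \<open>f\<close> is a permutation,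
      the second condition excludes as many points as the first.\<close>
    let ?E = "{x \<in> X. bad \<sigma> x} \<union> {x \<in> X. f x \<in> {x \<in> X. bad \<sigma> x}}"
    have "Z - ?good \<subseteq> (\<lambda>x. ?B' (\<sigma> x)) ` ?E"
    proof
      fix y assume y: "y \<in> Z - ?good"
      define z where "z = (y + 1) mod int n"
      have z: "z \<in> Z" using nbd by (simp add: z_def Z_def)
      have "?B' (\<sigma> (g z)) = y" using y \<sigma>g[OF z] by (simp add: z_def mod_simps) (simp add: Z_def)
      moreover have "g z \<in> ?E" using rec[of y] y gX[OF z] f(1) unfolding z_def by blast
      ultimately show "y \<in> (\<lambda>x. ?B' (\<sigma> x)) ` ?E" by blast
    qed
    then have "card (Z - ?good) \<le> card ((\<lambda>x. ?B' (\<sigma> x)) ` ?E)"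
      using finX by (intro card_mono) auto
    also have "\<dots> \<le> card ?E" using finX by (intro card_image_le) auto
    also have "\<dots> \<le> card {x \<in> X. bad \<sigma> x} + card {x \<in> X. f x \<in> {x \<in> X. bad \<sigma> x}}" by (rule card_Un_le)
    also have "card {x \<in> X. f x \<in> {x \<in> X. bad \<sigma> x}} = card {x \<in> X. bad \<sigma> x}"
      using bijf by (rule card_vimage_bij_betw) auto
    finally have "real (card (Z - ?good)) \<le> \<epsilon> * n" using few by simp
    moreover have "card (Z - ?good) = card Z - card ?good" using finZ by (intro card_Diff_subset) auto
    moreover have "card ?good \<le> card Z" using finZ by (intro card_mono) auto
    ultimately have most: "real (card ?good) \<ge> (1 - \<epsilon>) * n" using cardZ by (simp add: algebra_simps)
    have carrier: "carrier (residue_ring (int n)) = Z" by (simp add: residue_ring_def Z_def)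
    have "F (y \<oplus>\<^bsub>residue_ring (int n)\<^esub> \<one>\<^bsub>residue_ring (int n)\<^esub>) = [m] \<cdot>\<^bsub>residue_ring (int n)\<^esub> F y
        \<longleftrightarrow> F ((y + 1) mod int n) = M (F y)" if "y \<in> Z" for y
    proof -
      have "F y \<in> Z" using bijF that by (rule bij_betwE[rule_format])
      then show ?thesis using add_pow_residue_ring[of "F y" n m] by (simp add: Z_def M_def) (simp add: residue_ring_def)
    qed
    then have "{y \<in> Z. F (y \<oplus>\<^bsub>residue_ring (int n)\<^esub> \<one>\<^bsub>residue_ring (int n)\<^esub>) = [m] \<cdot>\<^bsub>residue_ring (int n)\<^esub> F y} = ?good"
      by blast
    then show "let Zn = residue_ring (int n) in
       \<exists>f. bij_betw f (carrier Zn) (carrier Zn) \<and>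
           real (card {x \<in> carrier Zn. f (x \<oplus>\<^bsub>Zn\<^esub> \<one>\<^bsub>Zn\<^esub>) = [m] \<cdot>\<^bsub>Zn\<^esub> f x}) \<ge> (1 - \<epsilon>) * real n \<and>
           (\<forall>x\<in>carrier Zn. f (f (f (f x))) = x)"
      unfolding Let_def carrier using bijF F4 most by (intro exI[of _ F]) simp
  qed
qed

end
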